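(* Let $a,b$ be positive integers and let $A_{a,b}=\begin{pmatrix}1&1&1&1\\0&a&b&a+b\end{pmatrix}$. Then $u(A_{a,b})=g(A_{a,b})=2(a+b)/\gcd(a,b)$.
   Context: Graver basis: for $A\in\mathbb{Z}^{d\times n}$, $\mathcal{G}(A):=\bigcup_{j=1}^{2^n}H_j\setminus\{0\}$, where $H_j$ is the inclusion-minimal Hilbert basis of the pointed rational cone $\{z\in\mathbb{O}_j: Az=0\}$ (i.e. the minimal generating set of the monoid of its integer points), and $\mathbb{O}_1,\dots,\mathbb{O}_{2^n}$ are the orthants of $\mathbb{R}^n$. Universal Gröbner basis: the toric ideal of $A$ is $\mathcal{I}_A:=\langle x^u-x^v : Au=Av,\ u,v\in\mathbb{Z}^n_+\rangle$ in the polynomial ring in $x_1,\dots,x_n$ over a field. For a term ordering $\prec$, the reduced Gröbner basis of $\mathcal{I}_A$ has the form $\{x^{w^+}-x^{w^-}: w\in\mathcal{G}_\prec(A)\}$ with $\mathcal{G}_\prec(A)\subseteq\ker(A)\cap\mathbb{Z}^n$, where $w=w^+-w^-$ is the decomposition into positive and negative parts. $\mathcal{U}(A)$ is the union of the sets $\mathcal{G}_\prec(A)$ over all term orderings $\prec$, where binomials are taken up to sign, so that $\mathcal{U}(A)$ is symmetric: $w\in\mathcal{U}(A)$ implies $-w\in\mathcal{U}(A)$. Higher Lawrence liftings: for a positive integer $N$, $$A^{(N)}:=\begin{pmatrix} I_n & I_n & \cdots & I_n\\ A & & & \\ & A & & \\ & & \ddots & \\ & & & A\end{pmatrix}$$ with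 $N$ blocks, $I_n$ being the $n\times n$ identity matrix. For $x=(x^1,\dots,x^N)$ with $x^i\in\mathbb{Z}^n$, the $x^i$ are the layers of $x$, and the type of $x$ is $|\{i: x^i\ne 0\}|$. Complexities: the Graver complexity $g(A)$ is the maximal type of an element of $\mathcal{G}(A^{(N)})$ over all $N$ (it is known that this is a finite constant depending only on $A$). The Gröbner complexity $u(A)$ is the maximal type of an element of $\mathcal{U}(A^{(N)})$ over all $N$. *)

theory Defs
  imports
    "HOL-Library.Poly_Mapping"
    "HOL-Library.Extended_Nat"
    "HOL-Algebra.Ideal"
    "Jordan_Normal_Form.Matrix_Kernel"
begin

text \<open>The orthants of real \<open>n\<close>-space are indexed by the set \<open>J\<close> of coordinates required to be
  nonnegative; the others are required to be nonpositive.\<close>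

definition orthant :: "nat \<Rightarrow> nat set \<Rightarrow> real vec set" where
  "orthant n J = {z \<in> carrier_vec n. \<forall>i<n. if i \<in> J then 0 \<le> z $ i else z $ i \<le> 0}"

definition orthant_cone :: "int mat \<Rightarrow> nat set \<Rightarrow> real vec set" where
  "orthant_cone A J = orthant (dim_col A) J \<inter> mat_kernel (map_mat real_of_int A)"

definition integer_points :: "real vec set \<Rightarrow> int vec set" where
  "integer_points C = {z. map_vec real_of_int z \<in> C}"

inductive_set monoid_hull :: "nat \<Rightarrow> int vec set \<Rightarrow> int vec set"
  for n :: nat and S :: "int vec set"
  where
    zero: "0\<^sub>v n \<in> monoid_hull n S"
  | add: "x \<in> S \<Longrightarrow> y \<in> monoid_hull n S \<Longrightarrow> x + y \<in> monoid_hull n S"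

text \<open>An inclusion-minimal Hilbert basis of a cone \<open>C\<close> in real \<open>n\<close>-space. For pointed rational
  cones it exists and is unique.\<close>

definition generates_points :: "nat \<Rightarrow> real vec set \<Rightarrow> int vec set \<Rightarrow> bool" where
  "generates_points n C H \<longleftrightarrow> H \<subseteq> integer_points C \<and> monoid_hull n H = integer_points C"

definition is_minimal_hilbert_basis :: "nat \<Rightarrow> real vec set \<Rightarrow> int vec set \<Rightarrow> bool" where
  "is_minimal_hilbert_basis n C H \<longleftrightarrow>
     generates_points n C H \<and> (\<forall>H'. H' \<subset> H \<longrightarrow> \<not> generates_points n C H')"

definition graver_basis :: "int mat \<Rightarrow> int vec set" where
  "graver_basis A =
     \<Union> {H. \<exists>J \<subseteq> {..<dim_col A}. is_minimal_hilbert_basis (dim_col A) (orthant_cone A J) H}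
       - {0\<^sub>v (dim_col A)}"

text \<open>Monomials are represented by their exponents, as finitely supported functions on the
  indices of the variables, so that multiplication of monomials is addition of exponents. The
  polynomial ring in \<open>n\<close> variables consists of the polynomials that only involve the variables
  with index below \<open>n\<close>.\<close>

type_synonym monomial = "nat \<Rightarrow>\<^sub>0 nat"
type_synonym 'k mpolynomial = "monomial \<Rightarrow>\<^sub>0 'k"

definition monomials :: "nat \<Rightarrow> monomial set" where
  "monomials n = {t. Poly_Mapping.keys t \<subseteq> {..<n}}"

definition poly_ring :: "nat \<Rightarrow> 'k::field mpolynomial ring" where
  "poly_ring n = \<lparr>carrier = {p. Poly_Mapping.keys p \<subseteq> monomials n},
     mult = (*), one = 1, zero = 0, add = (+)\<rparr>"

definition mon_dvd :: "monomial \<Rightarrow> monomial \<Rightarrow> bool" where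
  "mon_dvd s t \<longleftrightarrow> (\<forall>i. Poly_Mapping.lookup s i \<le> Poly_Mapping.lookup t i)"

text \<open>\<open>(s, t) \<in> r\<close> means that \<open>s\<close> is smaller than or equal to \<open>t\<close> in the ordering.\<close>

definition term_ordering :: "nat \<Rightarrow> monomial rel \<Rightarrow> bool" where
  "term_ordering n r \<longleftrightarrow>
     linear_order_on (monomials n) r \<and>
     (\<forall>t \<in> monomials n. (0, t) \<in> r) \<and>
     (\<forall>s \<in> monomials n. \<forall>t \<in> monomials n. \<forall>u \<in> monomials n.
        (s, t) \<in> r \<longrightarrow> (s + u, t + u) \<in> r)"

definition lead_mon :: "monomial rel \<Rightarrow> 'k::field mpolynomial \<Rightarrow> monomial" where
  "lead_mon r p = (THE t. t \<in> Poly_Mapping.keys p \<and> (\<forall>s \<in> Poly_Mapping.keys p. (s, t) \<in> r))"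

definition is_groebner_basis ::
    "monomial rel \<Rightarrow> 'k::field mpolynomial set \<Rightarrow> 'k mpolynomial set \<Rightarrow> bool" where
  "is_groebner_basis r I G \<longleftrightarrow>
     finite G \<and> G \<subseteq> I - {0} \<and>
     (\<forall>f \<in> I - {0}. \<exists>g \<in> G. mon_dvd (lead_mon r g) (lead_mon r f))"

definition is_reduced_groebner_basis ::
    "monomial rel \<Rightarrow> 'k::field mpolynomial set \<Rightarrow> 'k mpolynomial set \<Rightarrow> bool" where
  "is_reduced_groebner_basis r I G \<longleftrightarrow>
     is_groebner_basis r I G \<and>
     (\<forall>g \<in> G. Poly_Mapping.lookup g (lead_mon r g) = 1) \<and>
     (\<forall>g \<in> G. \<forall>h \<in> G - {g}. \<forall>t \<in> Poly_Mapping.keys g. \<not> mon_dvd (lead_mon r h) t)"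

definition exponent :: "nat vec \<Rightarrow> monomial" where
  "exponent u = Abs_poly_mapping (\<lambda>i. if i < dim_vec u then u $ i else 0)"

definition xpow :: "nat vec \<Rightarrow> 'k::field mpolynomial" where
  "xpow u = Poly_Mapping.single (exponent u) 1"

definition toric_ideal :: "int mat \<Rightarrow> 'k::field mpolynomial set" where
  "toric_ideal A = Idl\<^bsub>poly_ring (dim_col A)\<^esub>
     {xpow u - xpow v | u v. u \<in> carrier_vec (dim_col A) \<and> v \<in> carrier_vec (dim_col A) \<and>
        A *\<^sub>v map_vec int u = A *\<^sub>v map_vec int v}"

text \<open>The function \<open>nat\<close> truncates negative integers to \<open>0\<close>, so \<open>pos_part w\<close> and \<open>neg_part w\<close>
  are the nonnegative vectors with disjoint supports whose difference is \<open>w\<close>.\<close>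

definition pos_part :: "int vec \<Rightarrow> nat vec" where
  "pos_part w = map_vec nat w"

definition neg_part :: "int vec \<Rightarrow> nat vec" where
  "neg_part w = map_vec nat (- w)"

text \<open>The vectors encoding the elements of the reduced Groebner basis (which exists and is
  unique) of the toric ideal. The argument of type \<open>'k itself\<close> is the coefficient field.\<close>

definition reduced_groebner_vectors ::
    "'k::field itself \<Rightarrow> int mat \<Rightarrow> monomial rel \<Rightarrow> int vec set" where
  "reduced_groebner_vectors K A r =
     {w \<in> mat_kernel A. \<exists>G :: 'k mpolynomial set.
        is_reduced_groebner_basis r (toric_ideal A) G \<and>
        xpow (pos_part w) - xpow (neg_part w) \<in> G}"

definition universal_groebner_basis :: "'k::field itself \<Rightarrow> int mat \<Rightarrow> int vec set" where
  "universal_groebner_basis K A =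
     (\<Union>r \<in> {r. term_ordering (dim_col A) r}.
        reduced_groebner_vectors K A r \<union> uminus ` reduced_groebner_vectors K A r)"

text \<open>Layer \<open>k\<close> of a vector occupies the coordinates from \<open>k * n\<close> up to \<open>k * n + n - 1\<close>.\<close>

definition lawrence_lifting :: "int mat \<Rightarrow> nat \<Rightarrow> int mat" where
  "lawrence_lifting A N =
     (let d = dim_row A; n = dim_col A in
      mat (n + N * d) (N * n) (\<lambda>(i, j).
        if i < n then (if j mod n = i then 1 else 0)
        else if (i - n) div d = j div n then A $$ ((i - n) mod d, j mod n)
        else 0))"

definition layer :: "nat \<Rightarrow> int vec \<Rightarrow> nat \<Rightarrow> int vec" where
  "layer n x k = vec n (\<lambda>j. x $ (k * n + j))"

definition vec_type :: "nat \<Rightarrow> nat \<Rightarrow> int vec \<Rightarrow> nat" where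
  "vec_type n N x = card {k. k < N \<and> layer n x k \<noteq> 0\<^sub>v n}"

text \<open>The suprema are taken in \<open>enat\<close>: a finite value is a maximum attained by some element
  (or \<open>0\<close> if there are no elements), and the value is \<open>\<infinity>\<close> if the types are unbounded.\<close>

definition graver_complexity :: "int mat \<Rightarrow> enat" where
  "graver_complexity A =
     Sup {enat (vec_type (dim_col A) N x) | N x. 0 < N \<and> x \<in> graver_basis (lawrence_lifting A N)}"

definition groebner_complexity :: "'k::field itself \<Rightarrow> int mat \<Rightarrow> enat" where
  "groebner_complexity K A =
     Sup {enat (vec_type (dim_col A) N x) | N x.
            0 < N \<and> x \<in> universal_groebner_basis K (lawrence_lifting A N)}"

definition A_mat :: "nat \<Rightarrow> nat \<Rightarrow> int mat" where
  "A_mat a b = mat_of_rows_list 4 [[1, 1, 1, 1], [0, int a, int b, int a + int b]]"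

end

theory Submission
  imports Defs "HOL-Library.Product_Plus"
begin

text \<open>Put \<open>a = d \<alpha>\<close>, \<open>b = d \<beta>\<close> with \<open>d = gcd a b\<close> and \<open>l = \<alpha> + \<beta>\<close>. The kernel of the matrix is a
  plane, and in suitable coordinates its Graver basis consists of the vectors \<open>\<plusminus>(s, 1)\<close> with
  \<open>0 \<le> s \<le> l\<close> and \<open>\<plusminus>(1, 0)\<close>. Decomposing the layers of a Graver basis element of a Lawrence lifting
  into these vectors gives a minimal zero-sum family, so its type is at most the maximal length
  of such a family. Pairing the vectors \<open>(s, 1)\<close> and \<open>-(s', 1)\<close> in sorted order turns the family
  into a minimal zero-sum family of integers in an interval of length about \<open>l\<close>, and this bounds
  the length by \<open>2 l\<close>.

  The family of one vector \<open>(l, 1)\<close>, \<open>l - 1\<close> vectors \<open>(0, 1)\<close> and \<open>l\<close> vectors \<open>-(1, 1)\<close> attains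
  the bound. Its binomial lies in a reduced Groebner basis: each layer spans an edge of its layer
  polytope, so there is a weight for which the two monomials are the only minimal ones of
  their fiber. Elements of reduced Groebner bases are primitive, so both complexities agree.\<close>

section \<open>Minimal zero-sum families\<close>

text \<open>The greedy count of partial sums is one-dimensional, so the heights have to be removed
  first. All heights are -1, 0 or 1, and pairing removes them at the price of a factor 2: a pair is
  one integer but two steps. If differences of both signs occur, their range, at most
  \<open>l\<close> by sorting, is the window, so pairs and horizontal steps together number at most
  \<open>l\<close>. If all differences have one sign, the window grows to \<open>l + 1\<close>; but
  then the horizontal steps must compensate the pairs, so at most half of the members are pairs and
  the loss is harmless.

  For the lower bound, the identity blocks of the lifting couple the layers only by the condition
  that they sum to zero. Layerwise weights cut the fiber down to those corners of a cube, with each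
  layer either kept or flipped to its other end, that satisfy this condition. The flipped layers
  form a zero-sum subfamily, and minimality leaves two opposite corners. The weights tie these two,
  so the lexicographic tie-break decides which one leads.\<close>

definition minimal_zero_sum :: "'i set \<Rightarrow> ('i \<Rightarrow> 'a::ab_group_add) \<Rightarrow> bool" where
  "minimal_zero_sum I f \<longleftrightarrow>
     finite I \<and> sum f I = 0 \<and> (\<forall>J \<subseteq> I. sum f J = 0 \<longrightarrow> J = {} \<or> J = I)"

lemma minimal_zero_sumD:
  assumes "minimal_zero_sum I f" "J \<subseteq> I" "sum f J = 0"
  shows "J = {} \<or> J = I"
  using assms unfolding minimal_zero_sum_def by blast

text \<open>Greedily appending an element of sign opposite to the current partial sum keeps all partial
  sums in a window of \<open>p + q\<close> integers; by minimality they are pairwise distinct.\<close>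

lemma card_minimal_zero_sum_int_le:
  fixes f :: "'i \<Rightarrow> int"
  assumes min: "minimal_zero_sum I f" and range: "\<And>i. i \<in> I \<Longrightarrow> - p \<le> f i \<and> f i \<le> q"
    and p: "1 \<le> p" and q: "1 \<le> q"
  shows "int (card I) \<le> p + q"
proof -
  have fin: "finite I" and sum0: "sum f I = 0"
    using min by (auto simp: minimal_zero_sum_def)
  \<comment> \<open>\<open>V\<close> collects the sums of the subsets visited before
    \<open>J\<close>. The window is half-open because -p is never reached: a negative member is
    added only to a positive sum. A closed window would only give p + q + 1.\<close>
  have "\<exists>J V. J \<subseteq> I \<and> card J = n \<and> sum f J \<in> {-p<..q} \<and> V \<subseteq> {-p<..q} \<and> card V = n \<and>
          (\<forall>v\<in>V. \<exists>J'. J' \<subset> J \<and> sum f J' = v)" if "n \<le> card I" for n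
    using that
  proof (induction n)
    case 0
    show ?case by (intro exI[of _ "{}"]) (use p q in auto)
  next
    case (Suc n)
    then obtain J V where J: "J \<subseteq> I" "card J = n" "sum f J \<in> {-p<..q}" "V \<subseteq> {-p<..q}" "card V = n"
      and V: "\<And>v. v \<in> V \<Longrightarrow> \<exists>J'. J' \<subset> J \<and> sum f J' = v" by auto
    have finJ: "finite J" using J fin finite_subset by blast
    have finV: "finite V" using J finite_subset by blast
    have rest: "sum f (I - J) = - sum f J"
      using sum0 sum.subset_diff[OF J(1) fin, of f] by simp
    have "card (I - J) > 0" using J Suc.prems fin finJ card_Diff_subset by force
    then have ne: "I - J \<noteq> {}" by force
    have "\<exists>i \<in> I - J. sum f J + f i \<in> {-p<..q}"
    proof (cases "sum f J \<le> 0")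
      case True
      have "\<exists>i \<in> I - J. f i \<ge> 0"
      proof (rule ccontr)
        assume "\<not> ?thesis"
        then have "sum f (I - J) < sum (\<lambda>_. 0) (I - J)"
          using ne fin by (intro sum_strict_mono) (auto simp: not_le)
        with rest True show False by simp
      qed
      then obtain i where "i \<in> I - J" "f i \<ge> 0" by auto
      then show ?thesis using J True range[of i] by (intro bexI[of _ i]) auto
    next
      case False
      have "\<exists>i \<in> I - J. f i \<le> 0"
      proof (rule ccontr)
        assume "\<not> ?thesis"
        then have "sum f (I - J) > sum (\<lambda>_. 0) (I - J)"
          using ne fin by (intro sum_strict_mono) (auto simp: not_le)
        with rest False show False by simp
      qed
      then obtain i where "i \<in> I - J" "f i \<le> 0" by auto
      then show ?thesis using J False range[of i] by (intro bexI[of _ i]) auto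
    qed
    then obtain i where i: "i \<in> I - J" "sum f J + f i \<in> {-p<..q}" by blast
    have new: "sum f J \<notin> V"
    proof
      assume "sum f J \<in> V"
      then obtain J' where J': "J' \<subset> J" "sum f J' = sum f J" using V by blast
      have "sum f (J - J') = 0"
        using sum.subset_diff[of J' J f] J' finJ by auto
      moreover have "J - J' \<subseteq> I" "J - J' \<noteq> {}" "J - J' \<noteq> I" using J' J i by auto
      ultimately show False using minimal_zero_sumD[OF min] by blast
    qed
    show ?case
    proof (rule exI[of _ "insert i J"], rule exI[of _ "insert (sum f J) V"], intro conjI ballI)
      show "insert i J \<subseteq> I" using i J by auto
      show "card (insert i J) = Suc n" using i J finJ by simp
      show "sum f (insert i J) \<in> {-p<..q}" using i finJ by (simp add: add.commute)
      show "insert (sum f J) V \<subseteq> {-p<..q}" using J by simp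
      show "card (insert (sum f J) V) = Suc n" using new finV J by simp
      show "\<exists>J'. J' \<subset> insert i J \<and> sum f J' = v" if "v \<in> insert (sum f J) V" for v
        using that V i by (cases "v = sum f J") blast+
    qed
  qed
  from this[OF order.refl] obtain V where "V \<subseteq> {-p<..q}" "card V = card I" by blast
  then have "card I \<le> card {-p<..q}" by (metis card_mono finite_greaterThanAtMost_int)
  then show ?thesis using p q by simp
qed

lemma obtain_arg_max:
  fixes f :: "'i \<Rightarrow> 'b::linorder"
  assumes "finite X" "X \<noteq> {}"
  obtains x where "x \<in> X" "\<And>y. y \<in> X \<Longrightarrow> f y \<le> f x"
proof -
  have "Max (f ` X) \<in> f ` X" using assms by (intro Max_in) auto
  then obtain x where "x \<in> X" "f x = Max (f ` X)" by auto
  then show ?thesis using that[of x] assms by simp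
qed

text \<open>Match the two maxima and recurse on the rest. Only pairs with \<open>f i < f j\<close>
  are constrained, so ties in \<open>f\<close> may be matched in any order.\<close>

lemma ex_sorted_bij_betw:
  fixes f :: "'i \<Rightarrow> 'b::linorder" and g :: "'j \<Rightarrow> 'c::linorder"
  assumes "finite X" "finite Y" "card X = card Y"
  shows "\<exists>\<phi>. bij_betw \<phi> X Y \<and> (\<forall>i\<in>X. \<forall>j\<in>X. f i < f j \<longrightarrow> g (\<phi> i) \<le> g (\<phi> j))"
  using assms
proof (induction "card X" arbitrary: X Y)
  case 0
  then show ?case by (auto simp: bij_betw_def)
next
  case (Suc n)
  then have "X \<noteq> {}" "Y \<noteq> {}" by auto
  then obtain x y where x: "x \<in> X" "\<And>i. i \<in> X \<Longrightarrow> f i \<le> f x"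
    and y: "y \<in> Y" "\<And>j. j \<in> Y \<Longrightarrow> g j \<le> g y"
    using obtain_arg_max[OF Suc.prems(1), of f] obtain_arg_max[OF Suc.prems(2), of g] by metis
  obtain \<phi> where \<phi>: "bij_betw \<phi> (X - {x}) (Y - {y})"
    "\<forall>i\<in>X - {x}. \<forall>j\<in>X - {x}. f i < f j \<longrightarrow> g (\<phi> i) \<le> g (\<phi> j)"
    using Suc.hyps(1)[of "X - {x}" "Y - {y}"] Suc.prems Suc.hyps(2) x(1) y(1)
    by (metis card_Diff_singleton diff_Suc_1 finite_Diff)
  have eq: "X = insert x (X - {x})" "Y = insert y (Y - {y})" using x y by auto
  have "bij_betw (\<phi>(x := y)) (X - {x}) (Y - {y})"
    using \<phi>(1) by (subst bij_betw_cong[of _ _ \<phi>]) auto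
  then have "bij_betw (\<phi>(x := y)) (X - {x} \<union> {x}) (Y - {y} \<union> {y})"
    using notIn_Un_bij_betw[of x "X - {x}" "\<phi>(x := y)" "Y - {y}"] by simp
  then have bij: "bij_betw (\<phi>(x := y)) X Y"
    using eq by simp
  have "g ((\<phi>(x := y)) i) \<le> g ((\<phi>(x := y)) j)" if "i \<in> X" "j \<in> X" "f i < f j" for i j
  proof -
    have "(\<phi>(x := y)) i \<in> Y" using bij that by (auto simp: bij_betw_def)
    moreover have "i \<noteq> x" using that x(2)[of j] by auto
    ultimately show ?thesis using that y(2) \<phi>(2) by (cases "j = x") auto
  qed
  then have "\<forall>i\<in>X. \<forall>j\<in>X. f i < f j \<longrightarrow> g ((\<phi>(x := y)) i) \<le> g ((\<phi>(x := y)) j)" by blast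
  with bij show ?case by (intro exI conjI)
qed

section \<open>Zero-sum families of steps in the plane\<close>

definition steps :: "int \<Rightarrow> (int \<times> int) set" where
  "steps l = {0..l} \<times> {1} \<union> {-l..0} \<times> {-1} \<union> {-1, 1} \<times> {0}"

lemma steps_cases:
  assumes "p \<in> steps l"
  obtains "snd p = 1" "0 \<le> fst p" "fst p \<le> l"
    | "snd p = -1" "-l \<le> fst p" "fst p \<le> 0"
    | "snd p = 0" "fst p = 1 \<or> fst p = -1"
  using assms by (auto simp: steps_def)

lemma card_minimal_zero_sum_opposite:
  assumes min: "minimal_zero_sum I f" and ij: "i \<in> I" "j \<in> I" "i \<noteq> j" "f i + f j = 0"
  shows "card I = 2"
proof -
  have "I = {i, j}"
    using minimal_zero_sumD[OF min, of "{i, j}"] ij by simp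
  then show ?thesis using ij(3) by simp
qed

text \<open>Pairing the steps of height \<open>1\<close> with those of height \<open>-1\<close> in sorted order leaves
  a minimal zero-sum family of integers; sorting confines the differences within the pairs to
  an interval of length \<open>l\<close>.\<close>

theorem card_minimal_zero_sum_steps_le:
  fixes p :: "'i \<Rightarrow> int \<times> int"
  assumes min: "minimal_zero_sum I p" and steps: "\<And>i. i \<in> I \<Longrightarrow> p i \<in> steps l" and l: "2 \<le> l"
  shows "int (card I) \<le> 2 * l"
proof -
  define X where "X = {i \<in> I. snd (p i) = 1}"
  define Y where "Y = {i \<in> I. snd (p i) = -1}"
  define Z where "Z = {i \<in> I. snd (p i) = 0}"
  have fin: "finite I" and sum0: "sum p I = 0"
    using min by (auto simp: minimal_zero_sum_def)
  have finXYZ: "finite X" "finite Y" "finite Z"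
    using fin by (auto simp: X_def Y_def Z_def)
  have I: "I = X \<union> Y \<union> Z" and disj: "X \<inter> Y = {}" "(X \<union> Y) \<inter> Z = {}"
    using steps by (auto simp: X_def Y_def Z_def elim: steps_cases)
  have X: "0 \<le> fst (p i)" "fst (p i) \<le> l" if "i \<in> X" for i
    using that steps[of i] by (auto simp: X_def elim: steps_cases)
  have Y: "- l \<le> fst (p i)" "fst (p i) \<le> 0" if "i \<in> Y" for i
    using that steps[of i] by (auto simp: Y_def elim: steps_cases)
  have Z: "fst (p i) = 1 \<or> fst (p i) = -1" if "i \<in> Z" for i
    using that steps[of i] by (auto simp: Z_def elim: steps_cases)
  have "0 = (\<Sum>i\<in>I. snd (p i))"
    using sum0 by (metis snd_sum snd_zero)
  also have "\<dots> = (\<Sum>i\<in>X. snd (p i)) + (\<Sum>i\<in>Y. snd (p i)) + (\<Sum>i\<in>Z. snd (p i))"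
    unfolding I using disj finXYZ by (simp add: sum.union_disjoint)
  also have "\<dots> = int (card X) - int (card Y)"
    by (simp add: X_def Y_def Z_def)
  finally have cards: "card X = card Y" by simp
  obtain \<phi> where bij: "bij_betw \<phi> X Y"
    and \<phi>: "\<And>i j. i \<in> X \<Longrightarrow> j \<in> X \<Longrightarrow> fst (p i) < fst (p j) \<Longrightarrow> - fst (p (\<phi> i)) \<le> - fst (p (\<phi> j))"
    using ex_sorted_bij_betw[OF finXYZ(1,2) cards, of "\<lambda>i. fst (p i)" "\<lambda>i. - fst (p i)"] by blast
  have \<phi>Y: "\<phi> i \<in> Y" if "i \<in> X" for i
    using that bij by (auto simp: bij_betw_def)
  \<comment> \<open>The heights of a pair cancel, so only first entries survive; a horizontal step
    has no partner and enters with its own.\<close>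
  define v where "v i = fst (p i) + (if i \<in> X then fst (p (\<phi> i)) else 0)" for i
  define K where "K = X \<union> Z"
  \<comment> \<open>Closing \<open>U\<close> under partners turns a subset sum of \<open>v\<close>
    into one of \<open>p\<close>; this is how minimality passes from \<open>p\<close> to
    \<open>v\<close>.\<close>
  have sum_v: "sum p (U \<union> \<phi> ` (U \<inter> X)) = (sum v U, 0)" if U: "U \<subseteq> K" for U
  proof -
    have finU: "finite U" using U finXYZ finite_subset unfolding K_def by blast
    have "U \<inter> \<phi> ` (U \<inter> X) = {}" using U \<phi>Y disj unfolding K_def by blast
    moreover have "inj_on \<phi> (U \<inter> X)" using bij by (auto simp: bij_betw_def inj_on_def)
    ultimately have *: "(\<Sum>i\<in>U \<union> \<phi> ` (U \<inter> X). h (p i)) = (\<Sum>i\<in>U. h (p i) + (if i \<in> X then h (p (\<phi> i)) else 0))"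
      for h :: "int \<times> int \<Rightarrow> int"
      using finU by (simp add: sum.union_disjoint sum.reindex sum.distrib sum.inter_restrict)
    have "snd (p i) + (if i \<in> X then snd (p (\<phi> i)) else 0) = 0" if "i \<in> U" for i
      using that U \<phi>Y[of i] by (auto simp: K_def X_def Y_def Z_def)
    then show ?thesis
      by (intro prod_eqI) (simp_all add: fst_sum snd_sum * v_def)
  qed
  have minK: "minimal_zero_sum K v"
    unfolding minimal_zero_sum_def
  proof (intro conjI allI impI)
    show "finite K" using finXYZ by (simp add: K_def)
    have "K \<union> \<phi> ` (K \<inter> X) = I"
      using bij I by (auto simp: K_def bij_betw_def)
    then show "sum v K = 0" using sum_v[OF order.refl] sum0 by (simp add: zero_prod_def)
    fix U assume U: "U \<subseteq> K" "sum v U = 0"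
    have "U \<union> \<phi> ` (U \<inter> X) \<subseteq> I" using U(1) \<phi>Y I K_def by blast
    moreover have "sum p (U \<union> \<phi> ` (U \<inter> X)) = 0" using sum_v U by (simp add: zero_prod_def)
    ultimately consider "U \<union> \<phi> ` (U \<inter> X) = {}" | "U \<union> \<phi> ` (U \<inter> X) = I"
      using minimal_zero_sumD[OF min] by blast
    then show "U = {} \<or> U = K"
    proof cases
      case 2
      have "U = K"
      proof
        show "K \<subseteq> U"
        proof
          fix i assume i: "i \<in> K"
          then have "i \<in> U \<union> \<phi> ` (U \<inter> X)" "i \<notin> Y" using 2 I disj K_def by auto
          then show "i \<in> U" using \<phi>Y by blast
        qed
      qed (rule U)
      then show ?thesis ..
    qed simp
  qed
  have cardI: "int (card I) = 2 * int (card X) + int (card Z)"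
    unfolding I using finXYZ disj cards by (simp add: card_Un_disjoint)
  have cardK: "int (card K) = int (card X) + int (card Z)"
    unfolding K_def using finXYZ disj by (subst card_Un_disjoint) auto
  have v_X: "\<bar>v i\<bar> \<le> l" if "i \<in> X" for i
    using X[OF that] Y[OF \<phi>Y[OF that]] that by (simp add: v_def)
  \<comment> \<open>Write \<open>s\<close> for the first entry of a member and \<open>u\<close> for
    the negated first entry of its partner, so that \<open>v\<close> is \<open>s - u\<close>.
    Sorting gives the changes of \<open>s\<close> and of \<open>u\<close> from \<open>j\<close> to
    \<open>i\<close> the same sign, and each is at most \<open>l\<close> in size, so their
    difference is too.\<close>
  have v_diff: "v i - v j \<le> l" if "i \<in> X" "j \<in> X" for i j
    using X[OF that(1)] X[OF that(2)] Y[OF \<phi>Y[OF that(1)]] Y[OF \<phi>Y[OF that(2)]] \<phi>[of i j] \<phi>[of j i] that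
    by (cases "fst (p i) \<le> fst (p j)") (auto simp: v_def)
  have v_Z: "v i = fst (p i)" if "i \<in> Z" for i
    using that disj by (auto simp: v_def)
  have K_cases: "i \<in> X \<or> i \<in> Z" if "i \<in> K" for i using that by (simp add: K_def)
  consider (opposite) i j where "i \<in> Z" "j \<in> Z" "fst (p i) = 1" "fst (p j) = -1"
    | (zero) i where "i \<in> X" "v i = 0"
    | (pos_neg) i j where "i \<in> X" "j \<in> X" "v i > 0" "v j < 0"
    | (same_sign) e d :: int where "\<And>i. i \<in> Z \<Longrightarrow> v i = e" "\<And>i. i \<in> X \<Longrightarrow> d * v i > 0"
        "e = 1 \<or> e = -1" "d = 1 \<or> d = -1"
  proof -
    have "(\<exists>e. (e = 1 \<or> e = -1) \<and> (\<forall>i\<in>Z. v i = e)) \<or> (\<exists>i\<in>Z. \<exists>j\<in>Z. fst (p i) = 1 \<and> fst (p j) = -1)"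
      using Z v_Z by metis
    moreover have "(\<exists>d. (d = 1 \<or> d = -1) \<and> (\<forall>i\<in>X. d * v i > 0)) \<or> (\<exists>i\<in>X. v i = 0)
        \<or> (\<exists>i\<in>X. \<exists>j\<in>X. v i > 0 \<and> v j < 0)"
    proof (cases "\<forall>i\<in>X. v i > 0")
      case True
      then show ?thesis by (intro disjI1 exI[of _ 1]) auto
    next
      case False
      then show ?thesis
        by (metis linorder_less_linear mult_minus1 neg_0_less_iff_less)
    qed
    ultimately show ?thesis using that by blast
  qed
  then show ?thesis
  proof cases
    case opposite
    then have "p i + p j = 0" by (simp add: Z_def prod_eq_iff)
    moreover have "i \<in> I" "j \<in> I" "i \<noteq> j" using opposite by (auto simp: I)
    ultimately have "card I = 2" by (intro card_minimal_zero_sum_opposite[OF min])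
    then show ?thesis using l by simp
  next
    case zero
    then have "K = {i}" using minimal_zero_sumD[OF minK, of "{i}"] by (simp add: K_def)
    then have "Z = {}" "X = {i}" using zero disj by (auto simp: K_def)
    then show ?thesis using l cardI by simp
  next
    case pos_neg
    then have "X \<noteq> {}" by auto
    then obtain x y where x: "x \<in> X" "\<And>i. i \<in> X \<Longrightarrow> v i \<le> v x"
      and y: "y \<in> X" "\<And>i. i \<in> X \<Longrightarrow> - v i \<le> - v y"
      using obtain_arg_max[OF finXYZ(1), of v] obtain_arg_max[OF finXYZ(1), of "\<lambda>i. - v i"] by metis
    \<comment> \<open>The extreme differences have absolute value at least 1, so the window between
      them also holds the horizontal steps.\<close>
    have xy: "v x \<ge> 1" "v y \<le> -1" using x(2)[of i] y(2)[of j] pos_neg by auto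
    have "int (card K) \<le> - v y + v x"
    proof (rule card_minimal_zero_sum_int_le[OF minK])
      fix k assume "k \<in> K"
      then show "- (- v y) \<le> v k \<and> v k \<le> v x"
        using K_cases[of k] x(2)[of k] y(2)[of k] v_Z[of k] Z[of k] xy by auto
    qed (use xy in auto)
    then show ?thesis using v_diff[OF x(1) y(1)] cardI cardK by simp
  next
    case same_sign
    \<comment> \<open>A zero total makes the horizontal steps offset each pair by at least 1, so at
      most half of \<open>K\<close> are pairs. As \<open>card I\<close> is
      \<open>card K + card X\<close>, the bound \<open>l + 1\<close> on \<open>card K\<close> is
      then enough.\<close>
    have "sum v K = sum v X + e * int (card Z)"
      unfolding K_def using finXYZ disj same_sign(1) by (subst sum.union_disjoint) auto
    then have "d * sum v X + d * (e * int (card Z)) = 0"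
      using minK by (simp add: minimal_zero_sum_def flip: distrib_left)
    moreover have "int (card X) \<le> d * sum v X"
      using sum_bounded_below[of X 1 "\<lambda>i. d * v i"] same_sign(2) by (force simp: sum_distrib_left)
    ultimately have XZ: "card X \<le> card Z" using same_sign(3,4) by auto
    have "int (card K) \<le> l + 1"
    proof (cases "d = 1")
      case True
      have "int (card K) \<le> 1 + l"
      proof (rule card_minimal_zero_sum_int_le[OF minK])
        fix k assume "k \<in> K"
        then show "- 1 \<le> v k \<and> v k \<le> l"
          using K_cases[of k] same_sign(1)[of k] same_sign(2)[of k] same_sign(3) v_X[of k] True l by auto
      qed (use l in auto)
      then show ?thesis by simp
    next
      case False
      show ?thesis
      proof (rule card_minimal_zero_sum_int_le[OF minK])
        fix k assume "k \<in> K"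
        then show "- l \<le> v k \<and> v k \<le> 1"
          using K_cases[of k] same_sign(1)[of k] same_sign(2)[of k] same_sign(3,4) v_X[of k] False l by auto
      qed (use l in auto)
    qed
    then show ?thesis using XZ cardI cardK l by linarith
  qed
qed

section \<open>Graver bases and primitive vectors\<close>

definition conformal_le :: "int vec \<Rightarrow> int vec \<Rightarrow> bool" where
  "conformal_le y x \<longleftrightarrow>
     (\<forall>i<dim_vec x. 0 \<le> y $ i \<and> y $ i \<le> x $ i \<or> x $ i \<le> y $ i \<and> y $ i \<le> 0)"

text \<open>Minimality in the conformal order replaces Hilbert bases: it needs no choice of an
  orthant, and all later arguments about the Graver basis go through it.\<close>

definition primitive :: "int mat \<Rightarrow> int vec \<Rightarrow> bool" where
  "primitive A x \<longleftrightarrow> x \<in> mat_kernel A \<and> x \<noteq> 0\<^sub>v (dim_col A) \<and>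
     (\<forall>y \<in> mat_kernel A. conformal_le y x \<longrightarrow> y = 0\<^sub>v (dim_col A) \<or> y = x)"

definition l1_norm :: "int vec \<Rightarrow> nat" where
  "l1_norm x = (\<Sum>i<dim_vec x. nat \<bar>x $ i\<bar>)"

lemma mat_kernel_dim:
  "x \<in> mat_kernel A \<Longrightarrow> dim_vec x = dim_col A"
  by (auto simp: mat_kernel_def)

lemma mat_kernel_zero:
  "0\<^sub>v (dim_col A) \<in> mat_kernel A"
  by (auto simp: mat_kernel_def)

lemma mat_kernel_add:
  assumes "x \<in> mat_kernel A" "y \<in> mat_kernel A"
  shows "x + y \<in> mat_kernel A"
  using assms by (auto simp: mat_kernel_def mult_add_distrib_mat_vec[of A "dim_row A" "dim_col A"])

lemma mat_kernel_diff:
  fixes A :: "'a::comm_ring_1 mat"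
  assumes "x \<in> mat_kernel A" "y \<in> mat_kernel A"
  shows "x - y \<in> mat_kernel A"
  using assms by (auto simp: mat_kernel_def mult_minus_distrib_mat_vec[of A "dim_row A" "dim_col A"])

lemma mat_kernel_uminus:
  fixes A :: "'a::comm_ring_1 mat"
  assumes "x \<in> mat_kernel A"
  shows "- x \<in> mat_kernel A"
proof -
  have "0\<^sub>v (dim_col A) - x = - x"
    using mat_kernel_dim[OF assms] by (intro eq_vecI) auto
  then show ?thesis using mat_kernel_diff[OF mat_kernel_zero assms] by simp
qed

lemma conformal_leD:
  "conformal_le y x \<Longrightarrow> i < dim_vec x \<Longrightarrow>
     0 \<le> y $ i \<and> y $ i \<le> x $ i \<or> x $ i \<le> y $ i \<and> y $ i \<le> 0"
  by (simp add: conformal_le_def)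

lemma conformal_le_diff:
  assumes "conformal_le y x" "dim_vec y = dim_vec x"
  shows "conformal_le (x - y) x"
  unfolding conformal_le_def
proof (intro allI impI)
  fix i assume "i < dim_vec x"
  then show "0 \<le> (x - y) $ i \<and> (x - y) $ i \<le> x $ i \<or> x $ i \<le> (x - y) $ i \<and> (x - y) $ i \<le> 0"
    using conformal_leD[OF assms(1), of i] assms(2) by auto
qed

lemma l1_norm_less:
  assumes "conformal_le y x" "dim_vec y = dim_vec x" "y \<noteq> x"
  shows "l1_norm y < l1_norm x"
proof -
  obtain i where i: "i < dim_vec x" "y $ i \<noteq> x $ i"
    using eq_vecI[of x y] assms(2,3) by auto
  have le: "nat \<bar>y $ j\<bar> \<le> nat \<bar>x $ j\<bar>" if "j < dim_vec x" for j
    using conformal_leD[OF assms(1) that] by auto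
  have "nat \<bar>y $ i\<bar> < nat \<bar>x $ i\<bar>"
    using conformal_leD[OF assms(1) i(1)] i(2) by auto
  then show ?thesis unfolding l1_norm_def assms(2)
    using le i(1) by (intro sum_strict_mono_ex1) auto
qed

lemma mem_integer_points_orthant_cone:
  "z \<in> integer_points (orthant_cone A J) \<longleftrightarrow>
     z \<in> mat_kernel A \<and> (\<forall>i<dim_col A. if i \<in> J then 0 \<le> z $ i else z $ i \<le> 0)"
proof (cases "z \<in> carrier_vec (dim_col A)")
  case True
  have "map_mat real_of_int A *\<^sub>v map_vec real_of_int z = map_vec real_of_int (A *\<^sub>v z)"
    using True
    by (intro of_int_hom.mult_mat_vec_hom[symmetric, of _ "dim_row A" "dim_col A"]) auto
  moreover have "map_vec real_of_int (A *\<^sub>v z) = 0\<^sub>v (dim_row A) \<longleftrightarrow> A *\<^sub>v z = 0\<^sub>v (dim_row A)"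
    by (auto simp: vec_eq_iff)
  ultimately have "map_vec real_of_int z \<in> mat_kernel (map_mat real_of_int A) \<longleftrightarrow> z \<in> mat_kernel A"
    using True by (simp add: mat_kernel_def)
  moreover have "map_vec real_of_int z \<in> orthant (dim_col A) J \<longleftrightarrow>
      (\<forall>i<dim_col A. if i \<in> J then 0 \<le> z $ i else z $ i \<le> 0)"
    using True by (simp add: orthant_def)
  ultimately show ?thesis
    by (auto simp: integer_points_def orthant_cone_def)
next
  case False
  then show ?thesis
    by (simp add: integer_points_def orthant_cone_def mat_kernel_def)
qed

lemma integer_points_add:
  assumes "x \<in> integer_points (orthant_cone A J)" "y \<in> integer_points (orthant_cone A J)"
  shows "x + y \<in> integer_points (orthant_cone A J)"
proof -
  have ker: "x \<in> mat_kernel A" "y \<in> mat_kernel A"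
    using assms by (simp_all add: mem_integer_points_orthant_cone)
  have "if i \<in> J then 0 \<le> (x + y) $ i else (x + y) $ i \<le> 0" if "i < dim_col A" for i
    using assms mat_kernel_dim[OF ker(2)] that
    by (auto simp: mem_integer_points_orthant_cone split: if_splits intro: add_nonpos_nonpos)
  then show ?thesis using mat_kernel_add[OF ker] by (simp add: mem_integer_points_orthant_cone)
qed

lemma monoid_hull_subset_integer_points:
  assumes "H \<subseteq> integer_points (orthant_cone A J)"
  shows "monoid_hull (dim_col A) H \<subseteq> integer_points (orthant_cone A J)"
proof
  fix x assume "x \<in> monoid_hull (dim_col A) H"
  then show "x \<in> integer_points (orthant_cone A J)"
  proof induction
    case zero
    show ?case by (auto simp: mem_integer_points_orthant_cone mat_kernel_zero)
  next
    case (add x y)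
    then show ?case using assms integer_points_add by blast
  qed
qed

lemma monoid_hull_carrier:
  assumes "x \<in> monoid_hull n S" "S \<subseteq> carrier_vec n"
  shows "x \<in> carrier_vec n"
  using assms by induction auto

lemma monoid_hull_incl:
  assumes "x \<in> S" "S \<subseteq> carrier_vec n"
  shows "x \<in> monoid_hull n S"
proof -
  have "x + 0\<^sub>v n = x" using assms by (intro right_zero_vec) auto
  then show ?thesis using monoid_hull.add[OF assms(1) monoid_hull.zero[of n S]] by simp
qed

lemma monoid_hull_add:
  assumes "x \<in> monoid_hull n S" "y \<in> monoid_hull n S" "S \<subseteq> carrier_vec n"
  shows "x + y \<in> monoid_hull n S"
  using assms(1)
proof induction
  case zero
  then show ?case using monoid_hull_carrier[OF assms(2,3)] assms(2) by simp
next
  case (add u v)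
  then have "u + v + y = u + (v + y)"
    using assms monoid_hull_carrier by (intro assoc_add_vec) blast+
  then show ?case using add by (simp add: monoid_hull.add)
qed

text \<open>A nonzero kernel vector that is not primitive splits conformally into two nonzero kernel
  vectors. Both stay in the orthant and have smaller \<open>l1_norm\<close>, so the splitting ends
  in primitive vectors.\<close>

lemma generates_points_primitive:
  "generates_points (dim_col A) (orthant_cone A J)
     {x \<in> integer_points (orthant_cone A J). primitive A x}" (is "generates_points ?n ?C ?H")
  unfolding generates_points_def
proof (intro conjI equalityI)
  show sub: "?H \<subseteq> integer_points ?C" by auto
  then show "monoid_hull ?n ?H \<subseteq> integer_points ?C" by (rule monoid_hull_subset_integer_points)
  have carrier: "?H \<subseteq> carrier_vec ?n" by (auto simp: primitive_def mat_kernel_def)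
  have "z \<in> monoid_hull ?n ?H" if "z \<in> integer_points ?C" for z
    using that
  proof (induction "l1_norm z" arbitrary: z rule: less_induct)
    case less
    have z: "z \<in> mat_kernel A" "dim_vec z = ?n"
      using less.prems mat_kernel_dim by (auto simp: mem_integer_points_orthant_cone)
    consider "z = 0\<^sub>v ?n" | "primitive A z"
      | y where "y \<in> mat_kernel A" "conformal_le y z" "y \<noteq> 0\<^sub>v ?n" "y \<noteq> z"
      using z by (auto simp: primitive_def)
    then show ?case
    proof cases
      case 3
      have y: "dim_vec y = ?n" using 3 mat_kernel_dim by blast
      have "z - y \<noteq> z"
      proof
        assume eq: "z - y = z"
        have "y $ i = 0" if "i < ?n" for i
          using arg_cong[OF eq, of "\<lambda>v. v $ i"] that y z by simp
        then show False using 3(3) y by (metis eq_vecI index_zero_vec)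
      qed
      moreover have "conformal_le (z - y) z" using 3 y z by (simp add: conformal_le_diff)
      moreover have "y \<in> integer_points ?C \<and> z - y \<in> integer_points ?C"
      proof -
        have "(if i \<in> J then 0 \<le> y $ i else y $ i \<le> 0) \<and>
            (if i \<in> J then 0 \<le> (z - y) $ i else (z - y) $ i \<le> 0)" if i: "i < ?n" for i
        proof -
          have "0 \<le> y $ i \<and> y $ i \<le> z $ i \<or> z $ i \<le> y $ i \<and> y $ i \<le> 0"
            using 3(2) i z by (simp add: conformal_le_def)
          moreover have "if i \<in> J then 0 \<le> z $ i else z $ i \<le> 0"
            using less.prems i by (simp add: mem_integer_points_orthant_cone)
          ultimately show ?thesis using i y z by (simp split: if_splits; linarith)
        qed
        then show ?thesis using 3(1) z by (simp add: mem_integer_points_orthant_cone mat_kernel_diff)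
      qed
      ultimately have "y \<in> monoid_hull ?n ?H" "z - y \<in> monoid_hull ?n ?H"
        using less.hyps[OF l1_norm_less, of y] less.hyps[OF l1_norm_less, of "z - y"] 3 y z by simp_all
      moreover have "y + (z - y) = z" using y z by (intro eq_vecI) auto
      ultimately show ?thesis using monoid_hull_add[OF _ _ carrier, of y "z - y"] by simp
    next
      case 2
      then show ?thesis using less.prems by (intro monoid_hull_incl[OF _ carrier]) simp
    qed (simp add: monoid_hull.zero)
  qed
  then show "integer_points ?C \<subseteq> monoid_hull ?n ?H" by blast
qed

text \<open>Inside an orthant nothing cancels, so each summand lies conformally below the sum. When
  a primitive vector is a generator plus a rest, the generator is therefore 0 or the vector
  itself.\<close>

lemma primitive_in_generators:
  assumes gen: "generates_points (dim_col A) (orthant_cone A J) H"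
    and x: "x \<in> integer_points (orthant_cone A J)" "primitive A x"
  shows "x \<in> H"
proof -
  have sub: "H \<subseteq> integer_points (orthant_cone A J)"
    and "x \<in> monoid_hull (dim_col A) H"
    using gen x by (auto simp: generates_points_def)
  from this(2) show ?thesis using x
  proof induction
    case zero
    then show ?case by (simp add: primitive_def)
  next
    case (add u v)
    have pts: "u \<in> integer_points (orthant_cone A J)" "v \<in> integer_points (orthant_cone A J)"
      using add monoid_hull_subset_integer_points[OF sub] sub by auto
    then have ker: "u \<in> mat_kernel A" "v \<in> mat_kernel A"
      by (auto simp: mem_integer_points_orthant_cone)
    note dims = mat_kernel_dim[OF ker(1)] mat_kernel_dim[OF ker(2)]
    have "conformal_le u (u + v)"
      unfolding conformal_le_def
    proof (intro allI impI)
      fix i assume "i < dim_vec (u + v)"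
      then show "0 \<le> u $ i \<and> u $ i \<le> (u + v) $ i \<or> (u + v) $ i \<le> u $ i \<and> u $ i \<le> 0"
        using pts dims by (cases "i \<in> J") (auto simp: mem_integer_points_orthant_cone)
    qed
    then consider "u = 0\<^sub>v (dim_col A)" | "u = u + v"
      using add.prems ker by (auto simp: primitive_def)
    then show ?case
    proof cases
      case 1
      then have "u + v = v" using dims by (intro eq_vecI) auto
      then show ?thesis using add by simp
    qed (use add in auto)
  qed
qed

text \<open>The primitive points of an orthant generate its points and lie in every generating set,
  so they form its only minimal Hilbert basis.\<close>

theorem graver_basis_iff_primitive:
  "x \<in> graver_basis A \<longleftrightarrow> primitive A x"
proof
  assume "x \<in> graver_basis A"
  then obtain J H where H: "is_minimal_hilbert_basis (dim_col A) (orthant_cone A J) H" "x \<in> H"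
    by (auto simp: graver_basis_def)
  let ?P = "{x \<in> integer_points (orthant_cone A J). primitive A x}"
  have "?P \<subseteq> H" using H primitive_in_generators by (auto simp: is_minimal_hilbert_basis_def)
  then have "?P = H"
    using H(1) generates_points_primitive[of A J] unfolding is_minimal_hilbert_basis_def by blast
  then show "primitive A x" using H(2) by blast
next
  assume x: "primitive A x"
  define J where "J = {i. i < dim_col A \<and> 0 \<le> x $ i}"
  let ?P = "{x \<in> integer_points (orthant_cone A J). primitive A x}"
  have "is_minimal_hilbert_basis (dim_col A) (orthant_cone A J) ?P"
    unfolding is_minimal_hilbert_basis_def
    using generates_points_primitive primitive_in_generators by blast
  moreover have "x \<in> ?P" using x by (auto simp: mem_integer_points_orthant_cone J_def primitive_def)
  moreover have "J \<subseteq> {..<dim_col A}" by (auto simp: J_def)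
  ultimately show "x \<in> graver_basis A"
    using x unfolding graver_basis_def by (auto simp: primitive_def)
qed

lemma primitive_uminus:
  assumes "primitive A x"
  shows "primitive A (- x)"
  unfolding primitive_def
proof (intro conjI ballI impI)
  have x: "x \<in> mat_kernel A" "x \<noteq> 0\<^sub>v (dim_col A)" and dim: "dim_vec x = dim_col A"
    using assms mat_kernel_dim by (auto simp: primitive_def)
  show "- x \<in> mat_kernel A" using x by (simp add: mat_kernel_uminus)
  show "- x \<noteq> 0\<^sub>v (dim_col A)"
    using x dim by (metis uminus_uminus_vec uminus_zero_vec)
  fix y assume y: "y \<in> mat_kernel A" "conformal_le y (- x)"
  have "conformal_le (- y) x"
    unfolding conformal_le_def
  proof (intro allI impI)
    fix i assume "i < dim_vec x"
    then show "0 \<le> (- y) $ i \<and> (- y) $ i \<le> x $ i \<or> x $ i \<le> (- y) $ i \<and> (- y) $ i \<le> 0"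
      using conformal_leD[OF y(2), of i] dim mat_kernel_dim[OF y(1)] by auto
  qed
  then have "- y = 0\<^sub>v (dim_col A) \<or> - y = x"
    using assms y mat_kernel_uminus by (auto simp: primitive_def)
  then show "y = 0\<^sub>v (dim_col A) \<or> y = - x"
    by (metis uminus_uminus_vec uminus_zero_vec)
qed

section \<open>Monomials\<close>

lemma mon_dvd_trans: "mon_dvd s t \<Longrightarrow> mon_dvd t u \<Longrightarrow> mon_dvd s u"
  unfolding mon_dvd_def using order_trans by blast

lemma mon_dvd_antisym: "mon_dvd s t \<Longrightarrow> mon_dvd t s \<Longrightarrow> s = t"
  by (intro poly_mapping_eqI) (simp add: mon_dvd_def order_antisym)

lemma mon_dvd_add: "mon_dvd s (s + u)"
  by (simp add: mon_dvd_def lookup_add)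

lemma mon_dvdE:
  assumes "mon_dvd s t"
  obtains u where "t = s + u"
proof
  show "t = s + (t - s)"
    using assms by (intro poly_mapping_eqI) (simp add: mon_dvd_def lookup_add minus_poly_mapping.rep_eq)
qed

lemma lookup_monomials: "t \<in> monomials n \<Longrightarrow> n \<le> i \<Longrightarrow> Poly_Mapping.lookup t i = 0"
  by (auto simp: monomials_def subset_iff in_keys_iff)

lemma zero_in_monomials [simp]: "0 \<in> monomials n"
  by (simp add: monomials_def)

lemma add_in_monomials_iff: "s + t \<in> monomials n \<longleftrightarrow> s \<in> monomials n \<and> t \<in> monomials n"
  by (auto simp: monomials_def subset_iff in_keys_iff lookup_add)

section \<open>Dickson's lemma\<close>

lemma ex_monotone_subseq_nat:
  fixes h :: "nat \<Rightarrow> nat"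
  obtains \<phi> :: "nat \<Rightarrow> nat" where "strict_mono \<phi>" "mono (\<lambda>k. h (\<phi> k))"
proof -
  obtain f where f: "strict_mono f" "monoseq (\<lambda>k. h (f k))"
    using seq_monosub by blast
  show ?thesis
  proof (cases "incseq (\<lambda>k. h (f k))")
    case True
    then show ?thesis using that f by blast
  next
    case False
    then have dec: "decseq (\<lambda>k. h (f k))" using f(2) by (simp add: monoseq_iff)
    \<comment> \<open>From an index attaining the minimum on, a non-increasing sequence is constant,
      hence also non-decreasing.\<close>
    obtain m where m: "\<And>k. h (f m) \<le> h (f k)"
      using ex_has_least_nat[of "\<lambda>_. True" 0 "\<lambda>k. h (f k)"] by auto
    have const: "h (f (m + k)) = h (f m)" for k
      using m[of "m + k"] dec by (simp add: antisym decseq_def)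
    have "strict_mono (\<lambda>k. f (m + k))"
      using f(1) by (simp add: strict_mono_def)
    then show ?thesis using that[of "\<lambda>k. f (m + k)"] const by (simp add: mono_def)
  qed
qed

lemma ex_monotone_subseq_monomials:
  fixes f :: "nat \<Rightarrow> monomial"
  shows "\<exists>\<phi> :: nat \<Rightarrow> nat. strict_mono \<phi> \<and> (\<forall>i<n. mono (\<lambda>k. Poly_Mapping.lookup (f (\<phi> k)) i))"
proof (induction n)
  case 0
  show ?case by (auto intro: exI[of _ id] simp: strict_mono_def)
next
  case (Suc n)
  then obtain \<phi> :: "nat \<Rightarrow> nat" where \<phi>: "strict_mono \<phi>" "\<And>i. i < n \<Longrightarrow> mono (\<lambda>k. Poly_Mapping.lookup (f (\<phi> k)) i)"
    by blast
  obtain \<psi> :: "nat \<Rightarrow> nat" where \<psi>: "strict_mono \<psi>" "mono (\<lambda>k. Poly_Mapping.lookup (f (\<phi> (\<psi> k))) n)"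
    by (rule ex_monotone_subseq_nat[of "\<lambda>k. Poly_Mapping.lookup (f (\<phi> k)) n"])
  have "mono \<psi>" using \<psi>(1) by (rule strict_mono_mono)
  then have "mono (\<lambda>k. Poly_Mapping.lookup (f (\<phi> (\<psi> k))) i)" if "i < Suc n" for i
    using \<phi>(2)[of i] \<psi>(2) that by (cases "i = n") (auto simp: mono_def)
  moreover have "strict_mono (\<lambda>k. \<phi> (\<psi> k))"
    using \<phi>(1) \<psi>(1) by (simp add: strict_mono_def)
  ultimately show ?case by (intro exI[of _ "\<lambda>k. \<phi> (\<psi> k)"]) auto
qed

text \<open>An injective sequence in an infinite antichain has a subsequence with non-decreasing
  exponents in each of the \<open>n\<close> variables, and the first two terms of it would be
  comparable.\<close>

lemma finite_mon_dvd_antichain: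
  assumes S: "S \<subseteq> monomials n" and anti: "\<And>s t. s \<in> S \<Longrightarrow> t \<in> S \<Longrightarrow> mon_dvd s t \<Longrightarrow> s = t"
  shows "finite S"
proof (rule ccontr)
  assume "infinite S"
  then obtain f :: "nat \<Rightarrow> monomial" where f: "inj f" "range f \<subseteq> S"
    using infinite_countable_subset by blast
  obtain \<phi> :: "nat \<Rightarrow> nat" where \<phi>: "strict_mono \<phi>" "\<And>i. i < n \<Longrightarrow> mono (\<lambda>k. Poly_Mapping.lookup (f (\<phi> k)) i)"
    using ex_monotone_subseq_monomials by blast
  have mem: "f k \<in> monomials n" "f k \<in> S" for k using f S by auto
  have "Poly_Mapping.lookup (f (\<phi> 0)) i \<le> Poly_Mapping.lookup (f (\<phi> 1)) i" for i
    using monoD[OF \<phi>(2), of i 0 1] lookup_monomials[OF mem(1), of i] by (cases "i < n") auto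
  then have "mon_dvd (f (\<phi> 0)) (f (\<phi> 1))" by (simp add: mon_dvd_def)
  then have "\<phi> 0 = \<phi> 1" using anti mem f(1) by (metis injD)
  moreover have "\<phi> 0 < \<phi> 1" using \<phi>(1) by (simp add: strict_mono_def)
  ultimately show False by simp
qed

definition mon_dvd_minimal :: "monomial set \<Rightarrow> monomial set" where
  "mon_dvd_minimal S = {m \<in> S. \<forall>t \<in> S. mon_dvd t m \<longrightarrow> t = m}"

lemma finite_mon_dvd_minimal: "S \<subseteq> monomials n \<Longrightarrow> finite (mon_dvd_minimal S)"
  by (rule finite_mon_dvd_antichain[of _ n]) (auto simp: mon_dvd_minimal_def)

lemma ex_mon_dvd_minimal:
  assumes S: "S \<subseteq> monomials n" and s: "s \<in> S"
  shows "\<exists>m \<in> mon_dvd_minimal S. mon_dvd m s"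
proof -
  define deg where "deg t = (\<Sum>i<n. Poly_Mapping.lookup t i)" for t :: monomial
  have "s \<in> S \<and> mon_dvd s s" using s by (simp add: mon_dvd_def)
  then obtain m where m: "m \<in> S" "mon_dvd m s" "\<And>t. t \<in> S \<and> mon_dvd t s \<Longrightarrow> deg m \<le> deg t"
    using ex_has_least_nat[of "\<lambda>t. t \<in> S \<and> mon_dvd t s" s deg] by blast
  have "t = m" if t: "t \<in> S" "mon_dvd t m" for t
  proof (rule poly_mapping_eqI, rule ccontr)
    fix i assume i: "Poly_Mapping.lookup t i \<noteq> Poly_Mapping.lookup m i"
    then have "i < n" using lookup_monomials[of _ n i] S t(1) m(1) by (metis not_le subsetD)
    moreover have "Poly_Mapping.lookup t i < Poly_Mapping.lookup m i"
      using i t(2) by (simp add: mon_dvd_def order_less_le)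
    ultimately have "deg t < deg m"
      unfolding deg_def using t(2) by (intro sum_strict_mono_ex1) (auto simp: mon_dvd_def)
    moreover have "deg m \<le> deg t" using m t mon_dvd_trans by blast
    ultimately show False by simp
  qed
  then show ?thesis using m by (auto simp: mon_dvd_minimal_def)
qed

section \<open>Term orderings\<close>

lemma term_orderingD:
  assumes "term_ordering n r"
  shows "r \<subseteq> monomials n \<times> monomials n"
    and "s \<in> monomials n \<Longrightarrow> (s, s) \<in> r"
    and "(s, t) \<in> r \<Longrightarrow> (t, u) \<in> r \<Longrightarrow> (s, u) \<in> r"
    and "(s, t) \<in> r \<Longrightarrow> (t, s) \<in> r \<Longrightarrow> s = t"
    and "s \<in> monomials n \<Longrightarrow> t \<in> monomials n \<Longrightarrow> (s, t) \<in> r \<or> (t, s) \<in> r"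
    and "t \<in> monomials n \<Longrightarrow> (0, t) \<in> r"
    and "(s, t) \<in> r \<Longrightarrow> u \<in> monomials n \<Longrightarrow> (s + u, t + u) \<in> r"
proof -
  have lin: "r \<subseteq> monomials n \<times> monomials n" "refl_on (monomials n) r" "trans r" "antisym r" "total_on (monomials n) r"
    and add: "\<And>t. t \<in> monomials n \<Longrightarrow> (0, t) \<in> r"
      "\<And>s t u. s \<in> monomials n \<Longrightarrow> t \<in> monomials n \<Longrightarrow> u \<in> monomials n \<Longrightarrow> (s, t) \<in> r \<Longrightarrow> (s + u, t + u) \<in> r"
    using assms by (auto simp: term_ordering_def order_on_defs)
  show "r \<subseteq> monomials n \<times> monomials n" by (rule lin)
  show refl: "s \<in> monomials n \<Longrightarrow> (s, s) \<in> r" for s using lin(2) by (simp add: refl_on_def)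
  show "(s, t) \<in> r \<Longrightarrow> (t, u) \<in> r \<Longrightarrow> (s, u) \<in> r" using lin(3) by (rule transD)
  show "(s, t) \<in> r \<Longrightarrow> (t, s) \<in> r \<Longrightarrow> s = t" using lin(4) by (rule antisymD)
  show "s \<in> monomials n \<Longrightarrow> t \<in> monomials n \<Longrightarrow> (s, t) \<in> r \<or> (t, s) \<in> r"
    using lin(5) refl by (cases "s = t") (auto simp: total_on_def)
  show "t \<in> monomials n \<Longrightarrow> (0, t) \<in> r" by (rule add)
  show "(s, t) \<in> r \<Longrightarrow> u \<in> monomials n \<Longrightarrow> (s + u, t + u) \<in> r" using lin(1) add(2) by blast
qed

lemma ex_greatest_finite:
  assumes "term_ordering n r" "finite S" "S \<noteq> {}" "S \<subseteq> monomials n"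
  shows "\<exists>m \<in> S. \<forall>s \<in> S. (s, m) \<in> r"
  using assms(2-4)
proof (induction rule: finite_ne_induct)
  case (singleton x)
  then show ?case using term_orderingD(2)[OF assms(1)] by auto
next
  case (insert x F)
  then obtain m where m: "m \<in> F" "\<And>s. s \<in> F \<Longrightarrow> (s, m) \<in> r" by auto
  have x: "x \<in> monomials n" "m \<in> monomials n" using insert m by auto
  show ?case
  proof (cases "(x, m) \<in> r")
    case True
    then show ?thesis using m by auto
  next
    case False
    then have "(m, x) \<in> r" using term_orderingD(5)[OF assms(1)] x by blast
    then have "(s, x) \<in> r" if "s \<in> insert x F" for s
      using that m(2) term_orderingD(2,3)[OF assms(1)] x by blast
    then show ?thesis by blast
  qed
qed

lemma ex_least_finite:
  assumes "term_ordering n r" "finite S" "S \<noteq> {}" "S \<subseteq> monomials n"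
  shows "\<exists>m \<in> S. \<forall>s \<in> S. (m, s) \<in> r"
  using assms(2-4)
proof (induction rule: finite_ne_induct)
  case (singleton x)
  then show ?case using term_orderingD(2)[OF assms(1)] by auto
next
  case (insert x F)
  then obtain m where m: "m \<in> F" "\<And>s. s \<in> F \<Longrightarrow> (m, s) \<in> r" by auto
  have x: "x \<in> monomials n" "m \<in> monomials n" using insert m by auto
  show ?case
  proof (cases "(m, x) \<in> r")
    case True
    then show ?thesis using m by auto
  next
    case False
    then have "(x, m) \<in> r" using term_orderingD(5)[OF assms(1)] x by blast
    then have "(x, s) \<in> r" if "s \<in> insert x F" for s
      using that m(2) term_orderingD(2,3)[OF assms(1)] x by blast
    then show ?thesis by blast
  qed
qed

lemma term_ordering_mon_dvd:
  assumes r: "term_ordering n r" and "mon_dvd s t" "t \<in> monomials n"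
  shows "(s, t) \<in> r"
proof -
  obtain u where "t = s + u" using assms(2) by (rule mon_dvdE)
  moreover then have "s \<in> monomials n" "u \<in> monomials n" using assms(3) by (auto simp: add_in_monomials_iff)
  ultimately show ?thesis
    using term_orderingD(7)[OF r, of 0 u s] term_orderingD(6)[OF r, of u] by (simp add: add.commute)
qed

text \<open>A term ordering extends divisibility, so by Dickson's lemma only the finitely many
  divisibility-minimal members compete. This makes normal forms exist, even in infinite
  fibers.\<close>

lemma ex_least_monomial:
  assumes r: "term_ordering n r" and S: "S \<subseteq> monomials n" "S \<noteq> {}"
  shows "\<exists>m \<in> S. \<forall>s \<in> S. (m, s) \<in> r"
proof -
  have sub: "mon_dvd_minimal S \<subseteq> S" by (auto simp: mon_dvd_minimal_def)
  have "mon_dvd_minimal S \<noteq> {}" using ex_mon_dvd_minimal[OF S(1)] S(2) by blast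
  then obtain m where m: "m \<in> mon_dvd_minimal S" "\<And>s. s \<in> mon_dvd_minimal S \<Longrightarrow> (m, s) \<in> r"
    using ex_least_finite[OF r finite_mon_dvd_minimal[OF S(1)]] sub S(1) by blast
  have "(m, s) \<in> r" if s: "s \<in> S" for s
  proof -
    obtain t where t: "t \<in> mon_dvd_minimal S" "mon_dvd t s" using ex_mon_dvd_minimal[OF S(1) s] by blast
    then have "(t, s) \<in> r" using term_ordering_mon_dvd[OF r] s S(1) by blast
    then show ?thesis using m(2)[OF t(1)] term_orderingD(3)[OF r] by blast
  qed
  then show ?thesis using m(1) sub by blast
qed

lemma lead_mon_eqI:
  assumes "term_ordering n r" "t \<in> Poly_Mapping.keys p" "\<And>s. s \<in> Poly_Mapping.keys p \<Longrightarrow> (s, t) \<in> r"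
  shows "lead_mon r p = t"
  unfolding lead_mon_def
  by (rule the_equality) (use assms term_orderingD(4)[OF assms(1)] in blast)+

lemma lead_mon_in_keys:
  assumes r: "term_ordering n r" and p: "Poly_Mapping.keys p \<subseteq> monomials n" "p \<noteq> 0"
  shows "lead_mon r p \<in> Poly_Mapping.keys p"
    and "\<And>s. s \<in> Poly_Mapping.keys p \<Longrightarrow> (s, lead_mon r p) \<in> r"
proof -
  obtain m where "m \<in> Poly_Mapping.keys p" "\<And>s. s \<in> Poly_Mapping.keys p \<Longrightarrow> (s, m) \<in> r"
    using ex_greatest_finite[OF r, of "Poly_Mapping.keys p"] p by auto
  moreover from this have "lead_mon r p = m" by (rule lead_mon_eqI[OF r])
  ultimately show "lead_mon r p \<in> Poly_Mapping.keys p"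
    and "\<And>s. s \<in> Poly_Mapping.keys p \<Longrightarrow> (s, lead_mon r p) \<in> r" by auto
qed

definition toric_binomial :: "monomial \<Rightarrow> monomial \<Rightarrow> 'k::field mpolynomial" where
  "toric_binomial s t = Poly_Mapping.single s 1 - Poly_Mapping.single t 1"

lemma lookup_toric_binomial:
  "s \<noteq> t \<Longrightarrow> Poly_Mapping.lookup (toric_binomial s t) u = (if u = s then 1 else if u = t then -1 else 0)"
  by (auto simp: toric_binomial_def lookup_minus lookup_single when_def)

lemma keys_toric_binomial:
  "s \<noteq> t \<Longrightarrow> Poly_Mapping.keys (toric_binomial s t :: 'k::field mpolynomial) = {s, t}"
  by (auto simp: in_keys_iff lookup_toric_binomial split: if_splits)

lemma toric_binomial_eq_0_iff: "toric_binomial s t = (0 :: 'k::field mpolynomial) \<longleftrightarrow> s = t"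
  by (metis toric_binomial_def cancel_comm_monoid_add_class.diff_cancel insert_not_empty keys_toric_binomial keys_zero)

lemma lead_mon_toric_binomial:
  assumes "term_ordering n r" "s \<noteq> t" "(t, s) \<in> r"
  shows "lead_mon r (toric_binomial s t :: 'k::field mpolynomial) = s"
proof -
  have "s \<in> monomials n" using term_orderingD(1)[OF assms(1)] assms(3) by blast
  then show ?thesis
    using assms term_orderingD(2)[OF assms(1)] by (intro lead_mon_eqI[OF assms(1)]) (auto simp: keys_toric_binomial)
qed

section \<open>The toric ideal\<close>

definition exponent_vec :: "nat \<Rightarrow> monomial \<Rightarrow> int vec" where
  "exponent_vec n t = vec n (\<lambda>i. int (Poly_Mapping.lookup t i))"

definition same_fiber :: "int mat \<Rightarrow> monomial \<Rightarrow> monomial \<Rightarrow> bool" where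
  "same_fiber A s t \<longleftrightarrow> s \<in> monomials (dim_col A) \<and> t \<in> monomials (dim_col A) \<and>
     A *\<^sub>v exponent_vec (dim_col A) s = A *\<^sub>v exponent_vec (dim_col A) t"

lemma exponent_vec_carrier [simp]: "exponent_vec n t \<in> carrier_vec n"
  by (simp add: exponent_vec_def)

lemma exponent_vec_add: "exponent_vec n (s + t) = exponent_vec n s + exponent_vec n t"
  by (auto simp: exponent_vec_def lookup_add)

lemma same_fiber_refl: "t \<in> monomials (dim_col A) \<Longrightarrow> same_fiber A t t"
  by (simp add: same_fiber_def)

lemma same_fiber_sym: "same_fiber A s t \<Longrightarrow> same_fiber A t s"
  by (simp add: same_fiber_def)

lemma same_fiber_trans: "same_fiber A s t \<Longrightarrow> same_fiber A t u \<Longrightarrow> same_fiber A s u"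
  by (simp add: same_fiber_def)

lemma same_fiber_add:
  "same_fiber A s t \<Longrightarrow> u \<in> monomials (dim_col A) \<Longrightarrow> same_fiber A (s + u) (t + u)"
  by (simp add: same_fiber_def add_in_monomials_iff exponent_vec_add
      mult_add_distrib_mat_vec[of A "dim_row A" "dim_col A"])

lemma lookup_exponent:
  "Poly_Mapping.lookup (exponent u) i = (if i < dim_vec u then u $ i else 0)"
proof -
  have "{i. (if i < dim_vec u then u $ i else 0) \<noteq> 0} \<subseteq> {..<dim_vec u}" by auto
  then have "finite {i. (if i < dim_vec u then u $ i else 0) \<noteq> 0}" by (rule finite_subset) simp
  then show ?thesis by (simp add: exponent_def)
qed

lemma exponent_in_monomials: "u \<in> carrier_vec n \<Longrightarrow> exponent u \<in> monomials n"
  by (auto simp: monomials_def in_keys_iff lookup_exponent split: if_splits)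

lemma exponent_vec_exponent: "u \<in> carrier_vec n \<Longrightarrow> exponent_vec n (exponent u) = map_vec int u"
  by (intro eq_vecI) (auto simp: exponent_vec_def lookup_exponent)

lemma exponent_lookup:
  "t \<in> monomials n \<Longrightarrow> exponent (vec n (Poly_Mapping.lookup t)) = t"
  by (intro poly_mapping_eqI) (auto simp: lookup_exponent lookup_monomials)

section \<open>The polynomial ring and linear functionals on it\<close>

lemma poly_ring_simps [simp]:
  "carrier (poly_ring n) = {p. Poly_Mapping.keys p \<subseteq> monomials n}"
  "p \<otimes>\<^bsub>poly_ring n\<^esub> q = p * q" "p \<oplus>\<^bsub>poly_ring n\<^esub> q = p + q"
  "\<one>\<^bsub>poly_ring n\<^esub> = 1" "\<zero>\<^bsub>poly_ring n\<^esub> = 0"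
  by (simp_all add: poly_ring_def)

lemma keys_mult_monomials:
  assumes "Poly_Mapping.keys p \<subseteq> monomials n" "Poly_Mapping.keys q \<subseteq> monomials n"
  shows "Poly_Mapping.keys (p * q :: 'k::field mpolynomial) \<subseteq> monomials n"
proof
  fix t assume "t \<in> Poly_Mapping.keys (p * q)"
  then obtain u v where "u \<in> Poly_Mapping.keys p" "v \<in> Poly_Mapping.keys q" "t = u + v"
    using keys_mult[of p q] by blast
  then show "t \<in> monomials n" using assms by (auto simp: add_in_monomials_iff)
qed

lemma keys_add_monomials:
  assumes "Poly_Mapping.keys p \<subseteq> monomials n" "Poly_Mapping.keys q \<subseteq> monomials n"
  shows "Poly_Mapping.keys (p + q :: 'k::field mpolynomial) \<subseteq> monomials n"
  using assms Poly_Mapping.keys_add[of p q] by blast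

lemma keys_uminus_field: "Poly_Mapping.keys (- p :: 'k::field mpolynomial) = Poly_Mapping.keys p"
  by (auto simp: in_keys_iff)

lemma abelian_group_poly_ring: "abelian_group (poly_ring n :: 'k::field mpolynomial ring)"
proof (rule abelian_groupI)
  fix x :: "'k mpolynomial" assume "x \<in> carrier (poly_ring n)"
  then show "\<exists>y\<in>carrier (poly_ring n). y \<oplus>\<^bsub>poly_ring n\<^esub> x = \<zero>\<^bsub>poly_ring n\<^esub>"
    by (intro bexI[of _ "- x"]) (auto simp: keys_uminus_field)
qed (simp_all add: keys_add_monomials ac_simps)

lemma ring_poly_ring: "ring (poly_ring n :: 'k::field mpolynomial ring)"
proof (rule ringI)
  show "Group.monoid (poly_ring n :: 'k mpolynomial ring)"
    by (rule monoidI) (simp_all add: keys_mult_monomials mult.assoc)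
qed (auto simp: abelian_group_poly_ring distrib_left distrib_right)

text \<open>The linear functional with value \<open>h t\<close> at the monomial \<open>t\<close>.
  Those with \<open>h\<close> constant on fibers will turn out to vanish on the toric ideal.\<close>

definition linear_ext :: "(monomial \<Rightarrow> 'k) \<Rightarrow> 'k::field mpolynomial \<Rightarrow> 'k" where
  "linear_ext h f = (\<Sum>t\<in>Poly_Mapping.keys f. Poly_Mapping.lookup f t * h t)"

lemma linear_ext_superset:
  assumes "finite T" "Poly_Mapping.keys f \<subseteq> T"
  shows "linear_ext h f = (\<Sum>t\<in>T. Poly_Mapping.lookup f t * h t)"
  unfolding linear_ext_def
  by (rule sum.mono_neutral_left) (use assms in \<open>auto simp: in_keys_iff\<close>)

lemma linear_ext_add: "linear_ext h (f + g) = linear_ext h f + linear_ext h g"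
proof -
  let ?T = "Poly_Mapping.keys f \<union> Poly_Mapping.keys g"
  have "linear_ext h f = (\<Sum>t\<in>?T. Poly_Mapping.lookup f t * h t)"
    "linear_ext h g = (\<Sum>t\<in>?T. Poly_Mapping.lookup g t * h t)"
    "linear_ext h (f + g) = (\<Sum>t\<in>?T. Poly_Mapping.lookup (f + g) t * h t)"
    using Poly_Mapping.keys_add[of f g] by (intro linear_ext_superset; auto)+
  then show ?thesis by (simp add: lookup_add distrib_right sum.distrib)
qed

lemma linear_ext_0 [simp]: "linear_ext h 0 = 0"
  by (simp add: linear_ext_def)

lemma linear_ext_uminus: "linear_ext h (- f) = - linear_ext h f"
  by (simp add: linear_ext_def keys_uminus_field sum_negf)

lemma linear_ext_sum: "linear_ext h (sum f X) = (\<Sum>x\<in>X. linear_ext h (f x))"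
  by (induction X rule: infinite_finite_induct) (simp_all add: linear_ext_add)

lemma linear_ext_single: "linear_ext h (Poly_Mapping.single t c) = c * h t"
  by (cases "c = 0") (simp_all add: linear_ext_def)

lemma poly_mapping_expansion:
  fixes f :: "'a \<Rightarrow>\<^sub>0 'b::comm_monoid_add"
  shows "f = (\<Sum>t\<in>Poly_Mapping.keys f. Poly_Mapping.single t (Poly_Mapping.lookup f t))"
  by (intro poly_mapping_eqI) (auto simp: lookup_sum lookup_single when_def in_keys_iff)

lemma linear_ext_single_mult:
  "linear_ext h (Poly_Mapping.single u c * f) = c * linear_ext (\<lambda>t. h (u + t)) f"
proof -
  have "linear_ext h (Poly_Mapping.single u c * f) =
      linear_ext h (\<Sum>t\<in>Poly_Mapping.keys f. Poly_Mapping.single u c * Poly_Mapping.single t (Poly_Mapping.lookup f t))"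
    by (subst poly_mapping_expansion[of f]) (simp add: sum_distrib_left)
  also have "\<dots> = (\<Sum>t\<in>Poly_Mapping.keys f. c * Poly_Mapping.lookup f t * h (u + t))"
    by (simp add: linear_ext_sum mult_single linear_ext_single)
  also have "\<dots> = c * linear_ext (\<lambda>t. h (u + t)) f"
    by (simp add: linear_ext_def sum_distrib_left mult.assoc)
  finally show ?thesis .
qed

text \<open>An ideal containing the toric ideal. It detects that the leading monomial of an element of
  the toric ideal is not the smallest monomial of its fiber: otherwise it would be the only
  monomial of this fiber in the polynomial.\<close>

definition fiber_null :: "int mat \<Rightarrow> 'k::field mpolynomial set" where
  "fiber_null A = {f. Poly_Mapping.keys f \<subseteq> monomials (dim_col A) \<and>
     (\<forall>h. (\<forall>s t. same_fiber A s t \<longrightarrow> h s = h t) \<longrightarrow> linear_ext h f = 0)}"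

text \<open>Multiplication by a monomial \<open>u\<close> carries fibers into fibers, so
  \<open>h (u + t)\<close> is again constant on fibers as a function of \<open>t\<close>; linearity
  does the rest.\<close>

lemma fiber_null_mult:
  assumes f: "f \<in> fiber_null A" and g: "Poly_Mapping.keys g \<subseteq> monomials (dim_col A)"
  shows "g * f \<in> fiber_null A"
proof -
  have "linear_ext h (g * f) = 0" if h: "\<And>s t. same_fiber A s t \<Longrightarrow> h s = h t" for h
  proof -
    have "linear_ext (\<lambda>t. h (u + t)) f = 0" if "u \<in> Poly_Mapping.keys g" for u
    proof -
      have "h (u + s) = h (u + t)" if "same_fiber A s t" for s t
        using same_fiber_add[OF that, of u] g \<open>u \<in> _\<close> h by (metis add.commute subsetD)
      then show ?thesis using f by (simp add: fiber_null_def)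
    qed
    then have "(\<Sum>u\<in>Poly_Mapping.keys g. Poly_Mapping.lookup g u * linear_ext (\<lambda>t. h (u + t)) f) = 0"
      by simp
    moreover have "linear_ext h (g * f) =
        linear_ext h (\<Sum>u\<in>Poly_Mapping.keys g. Poly_Mapping.single u (Poly_Mapping.lookup g u) * f)"
      by (subst poly_mapping_expansion[of g]) (simp add: sum_distrib_right)
    ultimately show ?thesis by (simp add: linear_ext_sum linear_ext_single_mult)
  qed
  moreover have "Poly_Mapping.keys (g * f) \<subseteq> monomials (dim_col A)"
    using f g by (intro keys_mult_monomials) (auto simp: fiber_null_def)
  ultimately show ?thesis by (auto simp: fiber_null_def)
qed

lemma ideal_fiber_null: "ideal (fiber_null A :: 'k::field mpolynomial set) (poly_ring (dim_col A))"
proof (rule idealI[OF ring_poly_ring])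
  interpret R: ring "poly_ring (dim_col A) :: 'k mpolynomial ring" by (rule ring_poly_ring)
  show "subgroup (fiber_null A :: 'k mpolynomial set) (add_monoid (poly_ring (dim_col A)))"
  proof (rule R.add.subgroupI)
    fix f :: "'k mpolynomial" assume f: "f \<in> fiber_null A"
    then have "- f \<in> fiber_null A" by (auto simp: fiber_null_def linear_ext_uminus keys_uminus_field)
    moreover have "\<ominus>\<^bsub>poly_ring (dim_col A)\<^esub> f = - f"
      using f by (intro R.minus_equality) (auto simp: fiber_null_def keys_uminus_field)
    ultimately show "\<ominus>\<^bsub>poly_ring (dim_col A)\<^esub> f \<in> fiber_null A" by simp
  next
    show "(fiber_null A :: 'k mpolynomial set) \<noteq> {}"
      by (auto simp: fiber_null_def intro!: exI[of _ 0])
  qed (auto simp: fiber_null_def linear_ext_add dest: keys_add_monomials[THEN subsetD])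
next
  fix f g :: "'k mpolynomial" assume "f \<in> fiber_null A" "g \<in> carrier (poly_ring (dim_col A))"
  then show "g \<otimes>\<^bsub>poly_ring (dim_col A)\<^esub> f \<in> fiber_null A"
    "f \<otimes>\<^bsub>poly_ring (dim_col A)\<^esub> g \<in> fiber_null A"
    by (auto simp: fiber_null_mult mult.commute[of f])
qed

lemma toric_binomial_in_toric_ideal:
  assumes "same_fiber A s t"
  shows "(toric_binomial s t :: 'k::field mpolynomial) \<in> toric_ideal A"
proof -
  let ?n = "dim_col A"
  have st: "s \<in> monomials ?n" "t \<in> monomials ?n" using assms by (auto simp: same_fiber_def)
  define u v where "u = vec ?n (Poly_Mapping.lookup s)" and "v = vec ?n (Poly_Mapping.lookup t)"
  have "u \<in> carrier_vec ?n" "v \<in> carrier_vec ?n" by (simp_all add: u_def v_def)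
  moreover have "map_vec int u = exponent_vec ?n s" "map_vec int v = exponent_vec ?n t"
    by (auto simp: u_def v_def exponent_vec_def)
  then have "A *\<^sub>v map_vec int u = A *\<^sub>v map_vec int v"
    using assms by (simp add: same_fiber_def)
  moreover have "(toric_binomial s t :: 'k mpolynomial) = xpow u - xpow v"
    using st by (simp add: toric_binomial_def xpow_def u_def v_def exponent_lookup)
  ultimately have "(toric_binomial s t :: 'k mpolynomial) \<in> {xpow u - xpow v | u v.
      u \<in> carrier_vec ?n \<and> v \<in> carrier_vec ?n \<and> A *\<^sub>v map_vec int u = A *\<^sub>v map_vec int v}"
    by blast
  then show ?thesis unfolding toric_ideal_def genideal_def by blast
qed

lemma toric_ideal_subset_fiber_null: "(toric_ideal A :: 'k::field mpolynomial set) \<subseteq> fiber_null A"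
  unfolding toric_ideal_def
proof (rule ring.genideal_minimal[OF ring_poly_ring ideal_fiber_null], safe)
  fix u v :: "nat vec"
  assume u: "u \<in> carrier_vec (dim_col A)" and v: "v \<in> carrier_vec (dim_col A)"
    and eq: "A *\<^sub>v map_vec int u = A *\<^sub>v map_vec int v"
  have "same_fiber A (exponent u) (exponent v)"
    using u v eq by (simp add: same_fiber_def exponent_in_monomials exponent_vec_exponent)
  moreover have "Poly_Mapping.keys (xpow u - xpow v :: 'k mpolynomial) \<subseteq> {exponent u, exponent v}"
    by (auto simp: xpow_def in_keys_iff lookup_minus lookup_single when_def split: if_splits)
  moreover have "linear_ext h (xpow u - xpow v :: 'k mpolynomial) = h (exponent u) - h (exponent v)" for h
    using linear_ext_add[of h "xpow u" "- xpow v"] by (simp add: linear_ext_uminus xpow_def linear_ext_single)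
  ultimately show "(xpow u - xpow v :: 'k mpolynomial) \<in> fiber_null A"
    unfolding fiber_null_def same_fiber_def by (auto; metis)
qed

lemma lead_mon_toric_ideal:
  assumes r: "term_ordering (dim_col A) r" and f: "(f :: 'k::field mpolynomial) \<in> toric_ideal A" "f \<noteq> 0"
  shows "lead_mon r f \<in> monomials (dim_col A)"
    and "\<exists>s. same_fiber A s (lead_mon r f) \<and> s \<noteq> lead_mon r f \<and> (s, lead_mon r f) \<in> r"
proof -
  let ?m = "lead_mon r f"
  have null: "f \<in> fiber_null A" using f toric_ideal_subset_fiber_null by blast
  then have keys: "Poly_Mapping.keys f \<subseteq> monomials (dim_col A)" by (simp add: fiber_null_def)
  note lead = lead_mon_in_keys[OF r keys f(2)]
  show m: "?m \<in> monomials (dim_col A)" using lead(1) keys by blast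
  show "\<exists>s. same_fiber A s ?m \<and> s \<noteq> ?m \<and> (s, ?m) \<in> r"
  proof (rule ccontr)
    assume neg: "\<not> ?thesis"
    \<comment> \<open>Under the assumption no other monomial of \<open>f\<close> lies in the fiber
      of \<open>?m\<close>, so the indicator of this fiber picks out the leading
      coefficient.\<close>
    define h where "h t = (if same_fiber A t ?m then 1 else 0 :: 'k)" for t
    have "h s = h t" if "same_fiber A s t" for s t
      using that same_fiber_sym same_fiber_trans by (metis h_def)
    then have "0 = linear_ext h f" using null by (simp add: fiber_null_def)
    also have "\<dots> = (\<Sum>t\<in>Poly_Mapping.keys f. if t = ?m then Poly_Mapping.lookup f ?m else 0)"
      unfolding linear_ext_def
      by (rule sum.cong) (use neg lead same_fiber_refl[OF m] in \<open>auto simp: h_def\<close>)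
    also have "\<dots> = Poly_Mapping.lookup f ?m" using lead(1) by simp
    finally show False using lead(1) by (simp add: in_keys_iff)
  qed
qed

section \<open>Reduced Groebner bases of toric ideals\<close>

text \<open>The monomials of the initial ideal, described without polynomials: those that are not
  the smallest of their fiber.\<close>

definition nonstandard :: "int mat \<Rightarrow> monomial rel \<Rightarrow> monomial set" where
  "nonstandard A r = {m. \<exists>s. same_fiber A s m \<and> s \<noteq> m \<and> (s, m) \<in> r}"

definition normal_form :: "int mat \<Rightarrow> monomial rel \<Rightarrow> monomial \<Rightarrow> monomial" where
  "normal_form A r m = (SOME t. same_fiber A t m \<and> (\<forall>s. same_fiber A s m \<longrightarrow> (t, s) \<in> r))"

text \<open>The classical shape of the reduced basis: the minimal generators of the initial ideal
  are the heads, their normal forms the tails.\<close>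

definition toric_groebner_basis :: "int mat \<Rightarrow> monomial rel \<Rightarrow> 'k::field mpolynomial set" where
  "toric_groebner_basis A r =
     (\<lambda>m. toric_binomial m (normal_form A r m)) ` mon_dvd_minimal (nonstandard A r)"

lemma nonstandard_subset: "nonstandard A r \<subseteq> monomials (dim_col A)"
  by (auto simp: nonstandard_def same_fiber_def)

lemma nonstandard_mon_dvd:
  assumes r: "term_ordering (dim_col A) r" and m: "m \<in> nonstandard A r"
    and dvd: "mon_dvd m t" and t: "t \<in> monomials (dim_col A)"
  shows "t \<in> nonstandard A r"
proof -
  obtain s where s: "same_fiber A s m" "s \<noteq> m" "(s, m) \<in> r" using m by (auto simp: nonstandard_def)
  obtain u where u: "t = m + u" using dvd by (rule mon_dvdE)
  then have "u \<in> monomials (dim_col A)" using t by (simp add: add_in_monomials_iff)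
  then have "same_fiber A (s + u) t" "(s + u, t) \<in> r" "s + u \<noteq> t"
    using s same_fiber_add term_orderingD(7)[OF r] unfolding u by auto
  then show ?thesis unfolding nonstandard_def by blast
qed

lemma normal_form:
  assumes r: "term_ordering (dim_col A) r" and m: "m \<in> monomials (dim_col A)"
  shows "same_fiber A (normal_form A r m) m"
    and "same_fiber A s m \<Longrightarrow> (normal_form A r m, s) \<in> r"
    and "normal_form A r m \<notin> nonstandard A r"
    and "m \<in> nonstandard A r \<Longrightarrow> normal_form A r m \<noteq> m"
proof -
  let ?F = "{t. same_fiber A t m}"
  have "?F \<subseteq> monomials (dim_col A)" "?F \<noteq> {}"
    using same_fiber_refl[OF m] by (auto simp: same_fiber_def)
  from ex_least_monomial[OF r this]
  have "\<exists>t. same_fiber A t m \<and> (\<forall>s. same_fiber A s m \<longrightarrow> (t, s) \<in> r)" by blast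
  from someI_ex[OF this]
  have nf: "same_fiber A (normal_form A r m) m" "\<And>s. same_fiber A s m \<Longrightarrow> (normal_form A r m, s) \<in> r"
    unfolding normal_form_def by blast+
  show "same_fiber A (normal_form A r m) m" by (rule nf)
  show "same_fiber A s m \<Longrightarrow> (normal_form A r m, s) \<in> r" by (rule nf)
  show std: "normal_form A r m \<notin> nonstandard A r"
  proof
    assume "normal_form A r m \<in> nonstandard A r"
    then obtain s where "same_fiber A s (normal_form A r m)" "s \<noteq> normal_form A r m" "(s, normal_form A r m) \<in> r"
      by (auto simp: nonstandard_def)
    then show False using nf same_fiber_trans term_orderingD(4)[OF r] by blast
  qed
  show "m \<in> nonstandard A r \<Longrightarrow> normal_form A r m \<noteq> m" using std by auto
qed

text \<open>Tails are least in their fibers and so lie outside the initial ideal, while heads are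
  minimal in it; hence no head divides a monomial of another binomial.\<close>

theorem is_reduced_groebner_basis_toric:
  assumes r: "term_ordering (dim_col A) r"
  shows "is_reduced_groebner_basis r (toric_ideal A)
    (toric_groebner_basis A r :: 'k::field mpolynomial set)"
proof -
  let ?M = "mon_dvd_minimal (nonstandard A r)" and ?nf = "normal_form A r"
  have M: "m \<in> nonstandard A r" "m \<in> monomials (dim_col A)" if "m \<in> ?M" for m
    using that nonstandard_subset by (auto simp: mon_dvd_minimal_def)
  have ne: "m \<noteq> ?nf m" if "m \<in> ?M" for m
    using normal_form(4)[OF r M(2)[OF that] M(1)[OF that]] by simp
  have lead: "lead_mon r (toric_binomial m (?nf m) :: 'k mpolynomial) = m" if "m \<in> ?M" for m
    using normal_form(2)[OF r M(2)[OF that] same_fiber_refl[OF M(2)[OF that]]]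
    by (intro lead_mon_toric_binomial[OF r ne[OF that]])
  have "is_groebner_basis r (toric_ideal A) (toric_groebner_basis A r :: 'k mpolynomial set)"
    unfolding is_groebner_basis_def
  proof (intro conjI ballI)
    show "finite (toric_groebner_basis A r :: 'k mpolynomial set)"
      unfolding toric_groebner_basis_def
      by (intro finite_imageI finite_mon_dvd_minimal[OF nonstandard_subset])
    show "(toric_groebner_basis A r :: 'k mpolynomial set) \<subseteq> toric_ideal A - {0}"
      using normal_form(1)[OF r M(2)] ne
      by (auto simp: toric_groebner_basis_def toric_binomial_eq_0_iff intro: toric_binomial_in_toric_ideal same_fiber_sym)
    fix f :: "'k mpolynomial" assume f: "f \<in> toric_ideal A - {0}"
    then have "lead_mon r f \<in> nonstandard A r"
      using lead_mon_toric_ideal(2)[OF r, of f] by (simp add: nonstandard_def)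
    then obtain m where m: "m \<in> ?M" "mon_dvd m (lead_mon r f)"
      using ex_mon_dvd_minimal[OF nonstandard_subset] by blast
    then show "\<exists>g\<in>toric_groebner_basis A r. mon_dvd (lead_mon r (g :: 'k mpolynomial)) (lead_mon r f)"
      unfolding toric_groebner_basis_def using lead[OF m(1)] by (auto intro!: bexI[of _ m])
  qed
  moreover have "Poly_Mapping.lookup g (lead_mon r g) = 1"
    if "g \<in> toric_groebner_basis A r" for g :: "'k mpolynomial"
    using that lead ne by (auto simp: toric_groebner_basis_def lookup_toric_binomial)
  moreover have "\<not> mon_dvd (lead_mon r h) t"
    if gh: "g \<in> toric_groebner_basis A r" "h \<in> toric_groebner_basis A r - {g}"
      and t: "t \<in> Poly_Mapping.keys g" for g h :: "'k mpolynomial" and t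
  proof
    obtain m where m: "m \<in> ?M" "g = toric_binomial m (?nf m)"
      using gh(1) by (auto simp: toric_groebner_basis_def)
    obtain k where k: "k \<in> ?M" "h = toric_binomial k (?nf k)"
      using gh(2) by (auto simp: toric_groebner_basis_def)
    assume "mon_dvd (lead_mon r h) t"
    then have dvd: "mon_dvd k t" using lead[OF k(1)] k(2) by simp
    have "t \<in> monomials (dim_col A)"
      using t m ne[OF m(1)] M[OF m(1)] normal_form(1)[OF r M(2)[OF m(1)]]
      by (auto simp: keys_toric_binomial same_fiber_def)
    then have "t \<in> nonstandard A r" using nonstandard_mon_dvd[OF r M(1)[OF k(1)] dvd] by simp
    then have "t = m" using t m ne[OF m(1)] normal_form(3)[OF r M(2)[OF m(1)]] by (auto simp: keys_toric_binomial)
    then have "k = m" using dvd m(1) M(1)[OF k(1)] by (auto simp: mon_dvd_minimal_def)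
    then show False using gh(2) m k by auto
  qed
  ultimately show ?thesis by (simp add: is_reduced_groebner_basis_def)
qed

section \<open>Kernel vectors as pairs of monomials\<close>

lemma lookup_exponent_pos_part:
  "Poly_Mapping.lookup (exponent (pos_part w)) i = (if i < dim_vec w then nat (w $ i) else 0)"
  by (simp add: lookup_exponent pos_part_def)

lemma lookup_exponent_neg_part:
  "Poly_Mapping.lookup (exponent (neg_part w)) i = (if i < dim_vec w then nat (- w $ i) else 0)"
  by (simp add: lookup_exponent neg_part_def)

lemma exponent_parts_in_monomials:
  assumes "dim_vec w = n"
  shows "exponent (pos_part w) \<in> monomials n" "exponent (neg_part w) \<in> monomials n"
  using assms by (auto intro!: exponent_in_monomials carrier_vecI simp: pos_part_def neg_part_def)

lemma exponent_parts_eq_iff: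
  "exponent (pos_part w) = exponent (neg_part w) \<longleftrightarrow> w = 0\<^sub>v (dim_vec w)"
proof
  assume eq: "exponent (pos_part w) = exponent (neg_part w)"
  show "w = 0\<^sub>v (dim_vec w)"
  proof (rule eq_vecI)
    fix i assume i: "i < dim_vec (0\<^sub>v (dim_vec w) :: int vec)"
    then show "w $ i = 0\<^sub>v (dim_vec w) $ i"
      using arg_cong[OF eq, of "\<lambda>t. Poly_Mapping.lookup t i"]
      by (auto simp: lookup_exponent_pos_part lookup_exponent_neg_part)
  qed simp
next
  assume w: "w = 0\<^sub>v (dim_vec w)"
  have "w $ i = 0" if "i < dim_vec w" for i using w that by (metis index_zero_vec(1))
  then show "exponent (pos_part w) = exponent (neg_part w)"
    by (intro poly_mapping_eqI) (simp add: lookup_exponent_pos_part lookup_exponent_neg_part)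
qed

lemma mon_dvd_parts_eq_0:
  assumes "mon_dvd c (exponent (pos_part w))" "mon_dvd c (exponent (neg_part w))"
  shows "c = 0"
proof (rule poly_mapping_eqI)
  fix i
  have "Poly_Mapping.lookup c i \<le> (if i < dim_vec w then nat (w $ i) else 0)"
    "Poly_Mapping.lookup c i \<le> (if i < dim_vec w then nat (- w $ i) else 0)"
    using assms by (simp_all add: mon_dvd_def flip: lookup_exponent_pos_part lookup_exponent_neg_part)
  then show "Poly_Mapping.lookup c i = Poly_Mapping.lookup 0 i"
    by (cases "i < dim_vec w"; cases "w $ i \<ge> 0") auto
qed

text \<open>A conformal splitting has no cancellation in any coordinate, so positive and negative
  parts add up separately.\<close>

lemma exponent_parts_conformal:
  assumes "conformal_le y w" "dim_vec y = dim_vec w"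
  shows "exponent (pos_part y) + exponent (pos_part (w - y)) = exponent (pos_part w)"
    and "exponent (neg_part y) + exponent (neg_part (w - y)) = exponent (neg_part w)"
proof -
  have *: "nat (y $ i) + nat ((w - y) $ i) = nat (w $ i)"
    "nat (- y $ i) + nat (- (w - y) $ i) = nat (- w $ i)" if "i < dim_vec w" for i
    using conformal_leD[OF assms(1) that] that assms(2) by auto
  then show "exponent (pos_part y) + exponent (pos_part (w - y)) = exponent (pos_part w)"
    and "exponent (neg_part y) + exponent (neg_part (w - y)) = exponent (neg_part w)"
    using assms(2)
    by (auto intro!: poly_mapping_eqI simp: lookup_add lookup_exponent_pos_part lookup_exponent_neg_part)
qed

lemma same_fiber_parts:
  assumes "w \<in> mat_kernel A"
  shows "same_fiber A (exponent (pos_part w)) (exponent (neg_part w))"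
proof -
  let ?n = "dim_col A"
  have dim: "dim_vec w = ?n" using assms by (rule mat_kernel_dim)
  then have c: "pos_part w \<in> carrier_vec ?n" "neg_part w \<in> carrier_vec ?n"
    by (auto intro: carrier_vecI simp: pos_part_def neg_part_def)
  have "map_vec int (pos_part w) = map_vec int (neg_part w) + w"
    using dim by (intro eq_vecI) (auto simp: pos_part_def neg_part_def)
  then have "A *\<^sub>v map_vec int (pos_part w) = A *\<^sub>v map_vec int (neg_part w) + A *\<^sub>v w"
    using c assms by (simp add: mat_kernel_def mult_add_distrib_mat_vec[of A "dim_row A" ?n])
  also have "\<dots> = A *\<^sub>v map_vec int (neg_part w)"
    using assms by (intro eq_vecI) (simp_all add: mat_kernel_def)
  finally show ?thesis using c
    by (simp add: same_fiber_def exponent_in_monomials exponent_vec_exponent)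
qed

lemma same_fiber_diff_in_mat_kernel:
  assumes "same_fiber A s t"
  shows "exponent_vec (dim_col A) s - exponent_vec (dim_col A) t \<in> mat_kernel A"
proof -
  have "v - v = 0\<^sub>v (dim_row A)" if "dim_vec v = dim_row A" for v :: "int vec"
    using that by (intro eq_vecI) auto
  then show ?thesis
    using assms
    by (simp add: same_fiber_def mat_kernel_def mult_minus_distrib_mat_vec[of A "dim_row A" "dim_col A"])
qed

text \<open>In characteristic 2 the leading monomial of the binomial of \<open>w\<close> may be the negative part;
  hence only the support of \<open>g\<close> is fixed here.\<close>

lemma reduced_groebner_element_primitive:
  fixes G :: "'k::field mpolynomial set"
  assumes r: "term_ordering (dim_col A) r" and G: "is_reduced_groebner_basis r (toric_ideal A) G"
    and w: "w \<in> mat_kernel A" and g: "g \<in> G"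
    and keys: "Poly_Mapping.keys g = {exponent (pos_part w), exponent (neg_part w)}"
    and ne: "exponent (pos_part w) \<noteq> exponent (neg_part w)"
    and lead: "(exponent (neg_part w), exponent (pos_part w)) \<in> r"
  shows "primitive A w"
proof -
  define P N where "P y = exponent (pos_part y)" and "N y = exponent (neg_part y)" for y
  let ?n = "dim_col A"
  have mem: "P y \<in> monomials ?n" "N y \<in> monomials ?n" if "y \<in> mat_kernel A" for y
    using exponent_parts_in_monomials[OF mat_kernel_dim[OF that]] by (simp_all add: P_def N_def)
  have lead_g: "lead_mon r g = P w"
    using keys lead term_orderingD(2)[OF r mem(1)[OF w]]
    by (intro lead_mon_eqI[OF r]) (auto simp: P_def N_def)
  have binomial_lead: "\<exists>h\<in>G. mon_dvd (lead_mon r h) s"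
    if "same_fiber A s t" "s \<noteq> t" "(t, s) \<in> r" for s t
  proof -
    have "toric_binomial s t \<in> (toric_ideal A :: 'k mpolynomial set) - {0}"
      using that toric_binomial_in_toric_ideal by (auto simp: toric_binomial_eq_0_iff)
    then show ?thesis
      using G lead_mon_toric_binomial[OF r that(2,3), where 'k = 'k]
      unfolding is_reduced_groebner_basis_def is_groebner_basis_def by metis
  qed
  \<comment> \<open>By reducedness \<open>g\<close> is the only member whose leading monomial
    divides a monomial of \<open>g\<close>, and that leading monomial is \<open>P w\<close>.\<close>
  have reduced: "P w = lead_mon r h"
    if "h \<in> G" "mon_dvd (lead_mon r h) s" "mon_dvd s (P w) \<or> mon_dvd s (N w)" for h s
  proof -
    have "mon_dvd (lead_mon r h) (P w) \<or> mon_dvd (lead_mon r h) (N w)"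
      using that mon_dvd_trans by blast
    then have "\<exists>t\<in>Poly_Mapping.keys g. mon_dvd (lead_mon r h) t"
      using keys by (auto simp: P_def N_def)
    then have "h = g"
      using G g that(1) unfolding is_reduced_groebner_basis_def by blast
    then show ?thesis using lead_g by simp
  qed
  have not_pos_dvd_neg: "\<not> mon_dvd (P w) (N w)"
  proof
    assume dvd: "mon_dvd (P w) (N w)"
    then have "P w = 0"
      using mon_dvd_parts_eq_0[of "P w" w] by (simp add: P_def N_def mon_dvd_def)
    then show False
      using term_orderingD(4)[OF r lead] term_orderingD(6)[OF r mem(2)[OF w]] ne by (simp add: P_def N_def)
  qed
  \<comment> \<open>Some leading monomial divides \<open>P y\<close>, hence \<open>P w\<close>; so
    it equals \<open>P w\<close>, and \<open>P y = P w\<close>. The rest \<open>z\<close> then has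
    \<open>P z = 0\<close>. A nonzero \<open>N z\<close> would share a fiber with the exponent 0, so
    a leading monomial would divide it; this is again \<open>P w\<close>, which would then divide
    \<open>N w\<close>.\<close>
  have key: "y = w"
    if y: "y \<in> mat_kernel A" "conformal_le y w" "y \<noteq> 0\<^sub>v ?n" "(N y, P y) \<in> r" for y
  proof -
    have dims: "dim_vec y = ?n" "dim_vec w = ?n" using y w mat_kernel_dim by auto
    define z where "z = w - y"
    have z: "z \<in> mat_kernel A" using mat_kernel_diff w y by (simp add: z_def)
    have sum: "P y + P z = P w" "N y + N z = N w"
      using exponent_parts_conformal[OF y(2)] dims by (simp_all add: P_def N_def z_def)
    have "P y \<noteq> N y" using y(3) dims by (simp add: P_def N_def exponent_parts_eq_iff)
    then obtain h where h: "h \<in> G" "mon_dvd (lead_mon r h) (P y)"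
      using binomial_lead[OF same_fiber_parts[OF y(1)]] y(4) by (auto simp: P_def N_def)
    have Py: "mon_dvd (P y) (P w)" using mon_dvd_add[of "P y" "P z"] sum by simp
    then have "mon_dvd (P w) (P y)" using reduced[OF h] h(2) by simp
    then have "P y = P w" using Py mon_dvd_antisym by blast
    then have Pz: "P z = 0" using sum by simp
    have "N z = 0"
    proof (rule ccontr)
      assume Nz: "N z \<noteq> 0"
      have "same_fiber A (N z) 0"
        using same_fiber_sym[OF same_fiber_parts[OF z]] Pz by (simp add: P_def N_def)
      then obtain k where k: "k \<in> G" "mon_dvd (lead_mon r k) (N z)"
        using binomial_lead[of "N z" 0] Nz term_orderingD(6)[OF r mem(2)[OF z]] by blast
      have Nzw: "mon_dvd (N z) (N w)" using mon_dvd_add[of "N z" "N y"] sum by (simp add: add.commute)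
      then have "P w = lead_mon r k" using reduced[OF k] by blast
      then show False using k(2) Nzw mon_dvd_trans not_pos_dvd_neg by metis
    qed
    then have "z = 0\<^sub>v ?n"
      using Pz exponent_parts_eq_iff[of z] mat_kernel_dim[OF z] by (simp add: P_def N_def)
    then have "y + z = y" using dims by (intro eq_vecI) auto
    moreover have "y + z = w" unfolding z_def using dims by (intro eq_vecI) auto
    ultimately show ?thesis by simp
  qed
  show ?thesis
    unfolding primitive_def
  proof (intro conjI ballI impI)
    show "w \<in> mat_kernel A" by (rule w)
    show "w \<noteq> 0\<^sub>v ?n" using ne mat_kernel_dim[OF w] by (simp add: exponent_parts_eq_iff)
    fix y assume y: "y \<in> mat_kernel A" "conformal_le y w"
    have dims: "dim_vec y = ?n" "dim_vec w = ?n" using y w mat_kernel_dim by auto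
    define z where "z = w - y"
    have z: "z \<in> mat_kernel A" "conformal_le z w"
      using mat_kernel_diff w y conformal_le_diff dims by (simp_all add: z_def)
    have sum: "P y + P z = P w" "N y + N z = N w"
      using exponent_parts_conformal[OF y(2)] dims by (simp_all add: P_def N_def z_def)
    \<comment> \<open>If the negative part led in both summands, adding the two comparisons would
      contradict \<open>lead\<close>.\<close>
    have "(N y, P y) \<in> r \<or> (N z, P z) \<in> r"
    proof (rule ccontr)
      assume "\<not> ?thesis"
      then have "(P y, N y) \<in> r" "(P z, N z) \<in> r"
        using term_orderingD(5)[OF r] mem y(1) z(1) by blast+
      then have "(P w, N w) \<in> r"
        using term_orderingD(7)[OF r, of "P y" "N y" "P z"] term_orderingD(7)[OF r, of "P z" "N z" "N y"]
          term_orderingD(3)[OF r, of "P y + P z" "N y + P z" "N y + N z"] mem y(1) z(1)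
        by (simp add: sum add.commute[of "P z"] add.commute[of "N z"])
      then show False using term_orderingD(4)[OF r lead] ne by (simp add: P_def N_def)
    qed
    moreover have "z = w \<or> z = 0\<^sub>v ?n \<Longrightarrow> y = 0\<^sub>v ?n \<or> y = w"
    proof -
      assume "z = w \<or> z = 0\<^sub>v ?n"
      moreover have "y = w - z" using dims by (intro eq_vecI) (auto simp: z_def)
      ultimately show ?thesis using dims by auto
    qed
    ultimately show "y = 0\<^sub>v ?n \<or> y = w" using key[OF y] key[OF z] by blast
  qed
qed

theorem reduced_groebner_vector_primitive:
  assumes r: "term_ordering (dim_col A) r" and w: "w \<in> reduced_groebner_vectors TYPE('k::field) A r"
  shows "primitive A w"
proof -
  obtain G :: "'k mpolynomial set" where ker: "w \<in> mat_kernel A"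
    and G: "is_reduced_groebner_basis r (toric_ideal A) G" and g: "xpow (pos_part w) - xpow (neg_part w) \<in> G"
    using w by (auto simp: reduced_groebner_vectors_def)
  have eq: "xpow (pos_part w) - xpow (neg_part w) =
      (toric_binomial (exponent (pos_part w)) (exponent (neg_part w)) :: 'k mpolynomial)"
    by (simp add: toric_binomial_def xpow_def)
  have "(toric_binomial (exponent (pos_part w)) (exponent (neg_part w)) :: 'k mpolynomial) \<noteq> 0"
    using G g eq by (auto simp: is_reduced_groebner_basis_def is_groebner_basis_def)
  then have ne: "exponent (pos_part w) \<noteq> exponent (neg_part w)" by (simp add: toric_binomial_eq_0_iff)
  note keys = keys_toric_binomial[OF ne, where 'k = 'k]
  have swap: "pos_part (- w) = neg_part w" "neg_part (- w) = pos_part w"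
    by (simp_all add: pos_part_def neg_part_def)
  note mem = exponent_parts_in_monomials[OF mat_kernel_dim[OF ker]]
  show ?thesis
  proof (cases "(exponent (neg_part w), exponent (pos_part w)) \<in> r")
    case True
    then show ?thesis
      using reduced_groebner_element_primitive[OF r G ker g[unfolded eq]] keys ne by blast
  next
    \<comment> \<open>Here the negative part leads; \<open>- w\<close> has the same two monomials,
      so the previous lemma applies to it with the same element of \<open>G\<close>.\<close>
    case False
    then have "(exponent (pos_part w), exponent (neg_part w)) \<in> r"
      using term_orderingD(5)[OF r mem] by blast
    then have "primitive A (- w)"
      using reduced_groebner_element_primitive[OF r G mat_kernel_uminus[OF ker] g[unfolded eq]] keys ne
      by (simp add: swap insert_commute)
    then show ?thesis using primitive_uminus by fastforce
  qed
qed

text \<open>If the two monomials of \<open>w\<close> are the two smallest elements of their fiber, then no proper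
  divisor of the positive part can be reduced: the complementary factor would divide both
  monomials, whose supports are disjoint.\<close>

lemma reduced_groebner_vectorsI:
  assumes r: "term_ordering (dim_col A) r" and w: "w \<in> mat_kernel A" "w \<noteq> 0\<^sub>v (dim_col A)"
    and lead: "(exponent (neg_part w), exponent (pos_part w)) \<in> r"
    and smallest: "\<And>u. same_fiber A u (exponent (pos_part w)) \<Longrightarrow> (u, exponent (pos_part w)) \<in> r \<Longrightarrow>
      u = exponent (pos_part w) \<or> u = exponent (neg_part w)"
  shows "w \<in> reduced_groebner_vectors TYPE('k::field) A r"
proof -
  define P N where "P = exponent (pos_part w)" and "N = exponent (neg_part w)"
  have mem: "P \<in> monomials (dim_col A)" "N \<in> monomials (dim_col A)"
    using exponent_parts_in_monomials[OF mat_kernel_dim[OF w(1)]] by (simp_all add: P_def N_def)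
  have fiber: "same_fiber A P N" unfolding P_def N_def by (rule same_fiber_parts[OF w(1)])
  have ne: "P \<noteq> N" using w by (auto simp: P_def N_def exponent_parts_eq_iff dest: mat_kernel_dim)
  have P: "P \<in> nonstandard A r"
    using fiber ne lead by (auto simp: nonstandard_def P_def N_def intro: same_fiber_sym)
  have "t = P" if t: "t \<in> nonstandard A r" "mon_dvd t P" for t
  proof -
    obtain s where s: "same_fiber A s t" "s \<noteq> t" "(s, t) \<in> r" using t(1) by (auto simp: nonstandard_def)
    obtain c where c: "P = t + c" using t(2) by (rule mon_dvdE)
    then have "c \<in> monomials (dim_col A)" using mem(1) by (simp add: add_in_monomials_iff)
    then have "same_fiber A (s + c) P" "(s + c, P) \<in> r" "s + c \<noteq> P"
      using s same_fiber_add term_orderingD(7)[OF r] by (auto simp: c)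
    then have "s + c = N" using smallest by (auto simp: P_def N_def)
    then have "mon_dvd c P" "mon_dvd c N"
      using c mon_dvd_add[of c t] mon_dvd_add[of c s] by (simp_all add: add.commute)
    then have "c = 0" using mon_dvd_parts_eq_0 by (simp add: P_def N_def)
    then show ?thesis using c by simp
  qed
  then have "P \<in> mon_dvd_minimal (nonstandard A r)" using P by (auto simp: mon_dvd_minimal_def)
  moreover have "normal_form A r P = N"
    using smallest[of "normal_form A r P"] normal_form(1,2,4)[OF r mem(1)] same_fiber_refl[OF mem(1)] P
    by (auto simp: P_def N_def)
  ultimately have "(toric_binomial P N :: 'k mpolynomial) \<in> toric_groebner_basis A r"
    unfolding toric_groebner_basis_def by (intro rev_image_eqI[of P]) simp_all
  then have "(xpow (pos_part w) - xpow (neg_part w) :: 'k mpolynomial) \<in> toric_groebner_basis A r"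
    by (simp add: toric_binomial_def xpow_def P_def N_def)
  then show ?thesis
    using w is_reduced_groebner_basis_toric[OF r] unfolding reduced_groebner_vectors_def by blast
qed

section \<open>Kernels of Lawrence liftings\<close>

lemma sum_blocks:
  fixes f :: "nat \<Rightarrow> 'a::comm_monoid_add"
  shows "(\<Sum>j<N * n. f j) = (\<Sum>k<N. \<Sum>j<n. f (k * n + j))"
proof -
  have "(\<Sum>j<N * n. f j) = (\<Sum>k<N. sum f {k * n..<k * n + n})"
    by (rule sum.nat_group[symmetric])
  also have "\<dots> = (\<Sum>k<N. \<Sum>j<n. f (k * n + j))"
    by (simp add: sum.shift_bounds_nat_ivl[of f 0, simplified] atLeast0LessThan add.commute)
  finally show ?thesis .
qed

lemma layer_index_less: "k < N \<Longrightarrow> j < n \<Longrightarrow> k * n + j < N * (n::nat)"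
proof -
  assume "k < N" "j < n"
  then have "k * n + j < Suc k * n" by simp
  also have "\<dots> \<le> N * n" using \<open>k < N\<close> by (intro mult_le_mono1) simp
  finally show ?thesis .
qed

lemma vec_eq_0_iff: "dim_vec v = m \<Longrightarrow> v = 0\<^sub>v m \<longleftrightarrow> (\<forall>i<m. v $ i = 0)"
  by (metis eq_vecI index_zero_vec)

lemma mat_kernel_lawrence_lifting:
  assumes n: "0 < dim_col A" and d: "0 < dim_row A"
  shows "x \<in> mat_kernel (lawrence_lifting A N) \<longleftrightarrow> dim_vec x = N * dim_col A \<and>
    (\<forall>j<dim_col A. (\<Sum>k<N. x $ (k * dim_col A + j)) = 0) \<and>
    (\<forall>k<N. layer (dim_col A) x k \<in> mat_kernel A)"
proof (cases "dim_vec x = N * dim_col A")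
  case True
  let ?L = "lawrence_lifting A N" and ?n = "dim_col A" and ?d = "dim_row A"
  have dims: "dim_row ?L = ?n + N * ?d" "dim_col ?L = N * ?n"
    by (simp_all add: lawrence_lifting_def Let_def)
  have prod: "(?L *\<^sub>v x) $ i = (\<Sum>k<N. \<Sum>j<?n. ?L $$ (i, k * ?n + j) * x $ (k * ?n + j))"
    if "i < ?n + N * ?d" for i
    using that True dims by (simp add: scalar_prod_def atLeast0LessThan sum_blocks)
  have top: "(?L *\<^sub>v x) $ i = (\<Sum>k<N. x $ (k * ?n + i))" if i: "i < ?n" for i
  proof -
    have "?L $$ (i, k * ?n + j) * x $ (k * ?n + j) = (if j = i then x $ (k * ?n + i) else 0)"
      if "k < N" "j < ?n" for k j
      using that i layer_index_less[OF that] by (simp add: lawrence_lifting_def Let_def)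
    then have "(?L *\<^sub>v x) $ i = (\<Sum>k<N. \<Sum>j<?n. if j = i then x $ (k * ?n + i) else 0)"
      using i by (subst prod) (simp_all cong: sum.cong_simp)
    then show ?thesis using i by simp
  qed
  have block: "(?L *\<^sub>v x) $ (?n + (k * ?d + e)) = (A *\<^sub>v layer ?n x k) $ e" if k: "k < N" and e: "e < ?d" for k e
  proof -
    have lt: "k * ?d + e < N * ?d" by (rule layer_index_less[OF k e])
    have "?L $$ (?n + (k * ?d + e), m * ?n + j) * x $ (m * ?n + j) =
        (if m = k then A $$ (e, j) * x $ (k * ?n + j) else 0)" if "m < N" "j < ?n" for m j
      using that lt e layer_index_less[OF that] by (simp add: lawrence_lifting_def Let_def)
    then have "(?L *\<^sub>v x) $ (?n + (k * ?d + e)) =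
        (\<Sum>m<N. \<Sum>j<?n. if m = k then A $$ (e, j) * x $ (k * ?n + j) else 0)"
      using lt by (subst prod) (simp_all cong: sum.cong_simp)
    also have "\<dots> = (\<Sum>m<N. if m = k then \<Sum>j<?n. A $$ (e, j) * x $ (k * ?n + j) else 0)"
      by (intro sum.cong) simp_all
    also have "\<dots> = (\<Sum>j<?n. A $$ (e, j) * x $ (k * ?n + j))" using k by simp
    also have "\<dots> = (A *\<^sub>v layer ?n x k) $ e"
      using e by (simp add: scalar_prod_def layer_def atLeast0LessThan)
    finally show ?thesis .
  qed
  have "x \<in> mat_kernel ?L \<longleftrightarrow> (\<forall>i<?n + N * ?d. (?L *\<^sub>v x) $ i = 0)"
    unfolding mat_kernel_def using True dims by (subst vec_eq_0_iff[symmetric]) (auto intro: carrier_vecI)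
  also have "\<dots> \<longleftrightarrow> (\<forall>i<?n. (?L *\<^sub>v x) $ i = 0) \<and> (\<forall>k<N. \<forall>e<?d. (?L *\<^sub>v x) $ (?n + (k * ?d + e)) = 0)"
  proof (intro iffI conjI allI impI)
    fix k e assume "\<forall>i<?n + N * ?d. (?L *\<^sub>v x) $ i = 0" "k < N" "e < ?d"
    then show "(?L *\<^sub>v x) $ (?n + (k * ?d + e)) = 0"
      using layer_index_less[of k N e ?d] by simp
  next
    fix i assume *: "(\<forall>i<?n. (?L *\<^sub>v x) $ i = 0) \<and>
      (\<forall>k<N. \<forall>e<?d. (?L *\<^sub>v x) $ (?n + (k * ?d + e)) = 0)" and i: "i < ?n + N * ?d"
    show "(?L *\<^sub>v x) $ i = 0"
    proof (cases "i < ?n")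
      case False
      then have "(i - ?n) div ?d < N" "(i - ?n) mod ?d < ?d"
        "i = ?n + ((i - ?n) div ?d * ?d + (i - ?n) mod ?d)"
        using i d by (auto simp: less_mult_imp_div_less)
      then show ?thesis using * by metis
    qed (use * in blast)
  qed simp
  also have "\<dots> \<longleftrightarrow> (\<forall>j<?n. (\<Sum>k<N. x $ (k * ?n + j)) = 0) \<and> (\<forall>k<N. layer ?n x k \<in> mat_kernel A)"
  proof -
    have "layer ?n x k \<in> mat_kernel A \<longleftrightarrow> (\<forall>e<?d. (A *\<^sub>v layer ?n x k) $ e = 0)" for k
      by (subst vec_eq_0_iff[symmetric]) (simp_all add: mat_kernel_def layer_def)
    then show ?thesis using top block by (simp del: index_mult_mat_vec)
  qed
  finally show ?thesis using True by simp
next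
  case False
  then show ?thesis
    by (auto simp: mat_kernel_def lawrence_lifting_def Let_def)
qed

section \<open>The matrix of the theorem\<close>

text \<open>For \<open>a = d \<alpha>\<close> and \<open>b = d \<beta>\<close> with coprime \<open>\<alpha>\<close>, \<open>\<beta>\<close>, the pairs \<open>(s, t)\<close> parametrize
  the kernel of \<open>A_mat a b\<close>; \<open>coord \<alpha> \<beta> j\<close> is the \<open>j\<close>-th coordinate, and the elements of the
  Graver basis are the pairs in \<open>steps (\<alpha> + \<beta>)\<close>.\<close>

definition coord :: "int \<Rightarrow> int \<Rightarrow> nat \<Rightarrow> int \<times> int \<Rightarrow> int" where
  "coord \<alpha> \<beta> j p =
     (if j = 0 then fst p - \<beta> * snd p
      else if j = 1 then (\<alpha> + \<beta>) * snd p - fst p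
      else if j = 2 then - fst p
      else fst p - \<alpha> * snd p)"

definition stack :: "int \<Rightarrow> int \<Rightarrow> nat \<Rightarrow> (nat \<Rightarrow> int \<times> int) \<Rightarrow> int vec" where
  "stack \<alpha> \<beta> N q = vec (N * 4) (\<lambda>i. coord \<alpha> \<beta> (i mod 4) (q (i div 4)))"

lemma coord_simps [simp]:
  "coord \<alpha> \<beta> 0 p = fst p - \<beta> * snd p"
  "coord \<alpha> \<beta> (Suc 0) p = (\<alpha> + \<beta>) * snd p - fst p"
  "coord \<alpha> \<beta> 2 p = - fst p"
  "coord \<alpha> \<beta> 3 p = fst p - \<alpha> * snd p"
  by (simp_all add: coord_def)

lemma all_less_4: "(\<forall>j<4. P j) \<longleftrightarrow> P 0 \<and> P (Suc 0) \<and> P 2 \<and> P (3::nat)"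
  by (auto simp: numeral_eq_Suc less_Suc_eq)

lemma coord_0 [simp]: "coord \<alpha> \<beta> j 0 = 0"
  by (simp add: coord_def)

lemma coord_add: "coord \<alpha> \<beta> j (p + q) = coord \<alpha> \<beta> j p + coord \<alpha> \<beta> j q"
  by (simp add: coord_def algebra_simps)

lemma coord_uminus: "coord \<alpha> \<beta> j (- p) = - coord \<alpha> \<beta> j p"
  by (simp add: coord_def algebra_simps)

lemma coord_sum: "coord \<alpha> \<beta> j (sum f X) = (\<Sum>x\<in>X. coord \<alpha> \<beta> j (f x))"
  by (induction X rule: infinite_finite_induct) (simp_all add: coord_add)

lemma coord_eq_0:
  assumes "\<alpha> + \<beta> \<noteq> 0" "\<And>j. j < 4 \<Longrightarrow> coord \<alpha> \<beta> j p = 0"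
  shows "p = 0"
  using assms(1) assms(2)[of 1] assms(2)[of 2] by (simp add: prod_eq_iff)

lemma dim_stack [simp]: "dim_vec (stack \<alpha> \<beta> N q) = N * 4"
  by (simp add: stack_def)

lemma stack_index:
  "k < N \<Longrightarrow> j < 4 \<Longrightarrow> stack \<alpha> \<beta> N q $ (k * 4 + j) = coord \<alpha> \<beta> j (q k)"
  using layer_index_less[of k N j 4] by (simp add: stack_def)

lemma vec_4_eqI:
  assumes "dim_vec x = N * 4" "dim_vec y = N * 4"
    and "\<And>k j. k < N \<Longrightarrow> j < 4 \<Longrightarrow> x $ (k * 4 + j) = y $ (k * 4 + j)"
  shows "x = y"
proof (rule eq_vecI)
  fix i assume "i < dim_vec y"
  then have "i div 4 < N" "i mod 4 < 4" using assms(2) by (auto simp: less_mult_imp_div_less)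
  then show "x $ i = y $ i" using assms(3)[of "i div 4" "i mod 4"] by simp
qed (simp add: assms)

lemma stack_eq_iff:
  assumes "\<alpha> + \<beta> \<noteq> 0"
  shows "stack \<alpha> \<beta> N p = stack \<alpha> \<beta> N q \<longleftrightarrow> (\<forall>k<N. p k = q k)"
proof (intro iffI allI impI)
  fix k assume eq: "stack \<alpha> \<beta> N p = stack \<alpha> \<beta> N q" and k: "k < N"
  have "coord \<alpha> \<beta> j (p k + - q k) = 0" if "j < 4" for j
    using stack_index[OF k that, of \<alpha> \<beta> p] stack_index[OF k that, of \<alpha> \<beta> q] eq
    by (simp add: coord_add coord_uminus del: add_uminus_conv_diff)
  then have "p k + - q k = 0" by (rule coord_eq_0[OF assms])
  then show "p k = q k" by simp
next
  assume "\<forall>k<N. p k = q k"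
  then show "stack \<alpha> \<beta> N p = stack \<alpha> \<beta> N q"
    by (intro vec_4_eqI[of _ N]) (simp_all add: stack_index)
qed

lemma stack_0: "stack \<alpha> \<beta> N (\<lambda>_. 0) = 0\<^sub>v (N * 4)"
  by (auto simp: stack_def)

lemma layer_stack_eq_0_iff:
  assumes "\<alpha> + \<beta> \<noteq> 0" "k < N"
  shows "layer 4 (stack \<alpha> \<beta> N q) k = 0\<^sub>v 4 \<longleftrightarrow> q k = 0"
  using stack_index[OF assms(2)] coord_eq_0[OF assms(1), of "q k"]
  by (auto simp: layer_def vec_eq_iff)

lemma A_mat_dims [simp]: "dim_row (A_mat a b) = 2" "dim_col (A_mat a b) = 4"
  by (simp_all add: A_mat_def mat_of_rows_list_def)

text \<open>Divided by \<open>d\<close>, the second row reads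
  \<open>\<alpha> (v1 + v3) = - \<beta> (v2 + v3)\<close>, and coprimality yields
  \<open>v1 + v3 = \<beta> t\<close> and \<open>v2 + v3 = - \<alpha> t\<close>. With
  \<open>s = - v2\<close> as second parameter, the row of ones fixes \<open>v0\<close>; this is the
  origin of \<open>coord\<close>.\<close>

lemma mat_kernel_A_mat:
  assumes a: "a = d * \<alpha>" and b: "b = d * \<beta>" and pos: "0 < d" "0 < \<beta>" and coprime: "coprime \<alpha> \<beta>"
  shows "v \<in> mat_kernel (A_mat a b) \<longleftrightarrow> dim_vec v = 4 \<and> (\<exists>p. \<forall>j<4. v $ j = coord (int \<alpha>) (int \<beta>) j p)"
proof (cases "dim_vec v = 4")
  case True
  have sum4: "sum f {0..<4} = f 0 + f 1 + f 2 + f 3" for f :: "nat \<Rightarrow> int"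
    by (simp add: eval_nat_numeral)
  have "(A_mat a b *\<^sub>v v) $ 0 = v $ 0 + v $ 1 + v $ 2 + v $ 3"
    "(A_mat a b *\<^sub>v v) $ 1 = int a * v $ 1 + int b * v $ 2 + int (a + b) * v $ 3"
    using True by (simp_all add: scalar_prod_def sum4 A_mat_def mat_of_rows_list_def)
  moreover have "A_mat a b *\<^sub>v v = 0\<^sub>v 2 \<longleftrightarrow> (A_mat a b *\<^sub>v v) $ 0 = 0 \<and> (A_mat a b *\<^sub>v v) $ 1 = 0"
    unfolding vec_eq_iff by (simp add: less_2_cases_iff del: index_mult_mat_vec) (metis One_nat_def)
  moreover have "v \<in> carrier_vec 4" using True by (rule carrier_vecI)
  ultimately have "v \<in> mat_kernel (A_mat a b) \<longleftrightarrow> v $ 0 + v $ 1 + v $ 2 + v $ 3 = 0 \<and>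
      int a * v $ 1 + int b * v $ 2 + int (a + b) * v $ 3 = 0"
    by (simp add: mat_kernel_def)
  also have "int a * v $ 1 + int b * v $ 2 + int (a + b) * v $ 3 =
      int d * (int \<alpha> * (v $ 1 + v $ 3) + int \<beta> * (v $ 2 + v $ 3))"
    by (simp add: a b algebra_simps)
  also have "(v $ 0 + v $ 1 + v $ 2 + v $ 3 = 0 \<and> int d * (int \<alpha> * (v $ 1 + v $ 3) + int \<beta> * (v $ 2 + v $ 3)) = 0)
      \<longleftrightarrow> (\<exists>p. \<forall>j<4. v $ j = coord (int \<alpha>) (int \<beta>) j p)" (is "?l \<longleftrightarrow> ?r")
  proof
    assume l: ?l
    then have eq: "int \<alpha> * (v $ 1 + v $ 3) = int \<beta> * - (v $ 2 + v $ 3)"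
      using pos by (simp add: eq_neg_iff_add_eq_0 del: minus_add_distrib)
    then have "int \<beta> dvd int \<alpha> * (v $ 1 + v $ 3)" by (metis dvd_triv_left)
    then have "int \<beta> dvd v $ 1 + v $ 3" using coprime
      by (simp add: coprime_dvd_mult_right_iff coprime_commute)
    then obtain t where t: "v $ 1 + v $ 3 = int \<beta> * t" by (rule dvdE)
    then have "int \<beta> * (int \<alpha> * t) = int \<beta> * - (v $ 2 + v $ 3)" using eq by (simp add: mult.left_commute)
    then have "int \<alpha> * t = - (v $ 2 + v $ 3)" using pos by (metis mult_left_cancel of_nat_0_less_iff order_less_irrefl)
    then have "\<forall>j<4. v $ j = coord (int \<alpha>) (int \<beta>) j (- v $ 2, t)"
      using t l by (simp add: all_less_4 algebra_simps)
    then show ?r ..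
  next
    assume ?r
    then obtain p where "\<forall>j<4. v $ j = coord (int \<alpha>) (int \<beta>) j p" ..
    then have "v $ 1 + v $ 3 = int \<beta> * snd p" "v $ 2 + v $ 3 = - (int \<alpha> * snd p)"
      "v $ 0 + v $ 1 + v $ 2 + v $ 3 = 0"
      by (simp_all add: all_less_4 algebra_simps)
    then show ?l by (simp add: mult.left_commute)
  qed
  finally show ?thesis using True by simp
qed (auto dest: mat_kernel_dim)

text \<open>Since \<open>coord\<close> is additive and vanishes at all four indices only for the
  zero pair, the identity rows say exactly that the pairs of the layers sum to zero.\<close>

lemma mat_kernel_lawrence_A_mat:
  assumes a: "a = d * \<alpha>" and b: "b = d * \<beta>" and pos: "0 < d" "0 < \<alpha>" "0 < \<beta>" and coprime: "coprime \<alpha> \<beta>"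
  shows "x \<in> mat_kernel (lawrence_lifting (A_mat a b) N) \<longleftrightarrow>
    (\<exists>q. x = stack (int \<alpha>) (int \<beta>) N q \<and> (\<Sum>k<N. q k) = 0)"
proof
  assume "x \<in> mat_kernel (lawrence_lifting (A_mat a b) N)"
  then have dim: "dim_vec x = N * 4" and sum: "\<And>j. j < 4 \<Longrightarrow> (\<Sum>k<N. x $ (k * 4 + j)) = 0"
    and layers: "\<And>k. k < N \<Longrightarrow> layer 4 x k \<in> mat_kernel (A_mat a b)"
    by (auto simp: mat_kernel_lawrence_lifting)
  have "\<exists>p. \<forall>j<4. layer 4 x k $ j = coord (int \<alpha>) (int \<beta>) j p" if "k < N" for k
    using layers[OF that] by (simp add: mat_kernel_A_mat[OF a b pos(1,3) coprime])
  then obtain q where q: "\<And>k j. k < N \<Longrightarrow> j < 4 \<Longrightarrow> layer 4 x k $ j = coord (int \<alpha>) (int \<beta>) j (q k)"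
    by metis
  have x: "x = stack (int \<alpha>) (int \<beta>) N q"
    using q dim by (intro vec_4_eqI[of _ N]) (simp_all add: stack_index layer_def)
  have "(\<Sum>k<N. q k) = 0"
  proof (rule coord_eq_0)
    fix j :: nat assume "j < 4"
    then show "coord (int \<alpha>) (int \<beta>) j (\<Sum>k<N. q k) = 0"
      using sum[of j] by (simp add: coord_sum x stack_index)
  qed (use pos in simp)
  with x show "\<exists>q. x = stack (int \<alpha>) (int \<beta>) N q \<and> (\<Sum>k<N. q k) = 0" by blast
next
  assume "\<exists>q. x = stack (int \<alpha>) (int \<beta>) N q \<and> (\<Sum>k<N. q k) = 0"
  then obtain q where x: "x = stack (int \<alpha>) (int \<beta>) N q" and q: "(\<Sum>k<N. q k) = 0" by blast
  have "(\<Sum>k<N. x $ (k * 4 + j)) = 0" if "j < 4" for j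
    using arg_cong[OF q, of "coord (int \<alpha>) (int \<beta>) j"] that by (simp add: x stack_index coord_sum)
  moreover have "layer 4 x k \<in> mat_kernel (A_mat a b)" if "k < N" for k
    unfolding mat_kernel_A_mat[OF a b pos(1,3) coprime]
    using that by (intro conjI exI[of _ "q k"]) (simp_all add: layer_def x stack_index)
  ultimately show "x \<in> mat_kernel (lawrence_lifting (A_mat a b) N)"
    by (simp add: mat_kernel_lawrence_lifting x)
qed

section \<open>The upper bound\<close>

lemma uminus_in_steps: "p \<in> steps l \<Longrightarrow> - p \<in> steps l"
  by (cases p) (auto simp: steps_def)

lemma zero_notin_steps: "0 \<notin> steps l"
  by (auto simp: steps_def zero_prod_def)

definition same_orthant :: "int \<Rightarrow> int \<Rightarrow> int \<times> int \<Rightarrow> int \<times> int \<Rightarrow> bool" where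
  "same_orthant \<alpha> \<beta> p q \<longleftrightarrow> (\<forall>j<4. 0 \<le> coord \<alpha> \<beta> j p \<and> 0 \<le> coord \<alpha> \<beta> j q \<or>
     coord \<alpha> \<beta> j p \<le> 0 \<and> coord \<alpha> \<beta> j q \<le> 0)"

text \<open>Consecutive elements of \<open>steps\<close>, ordered by angle, span unimodular cones, and each of these
  cones lies in a single orthant.\<close>

lemma two_steps_decomposition:
  assumes pos: "1 \<le> \<alpha>" "1 \<le> \<beta>"
  shows "\<exists>u v m n. u \<in> steps (\<alpha> + \<beta>) \<and> v \<in> steps (\<alpha> + \<beta>) \<and> same_orthant \<alpha> \<beta> u v \<and>
    p = (int m * fst u + int n * fst v, int m * snd u + int n * snd v)"
proof -
  let ?P = "\<lambda>p. \<exists>u v m n. u \<in> steps (\<alpha> + \<beta>) \<and> v \<in> steps (\<alpha> + \<beta>) \<and> same_orthant \<alpha> \<beta> u v \<and>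
    p = (int m * fst u + int n * fst v, int m * snd u + int n * snd v)"
  have nonneg: "?P (s, t)" if t: "0 \<le> t" for s t
  proof -
    consider "t = 0" "0 \<le> s" | "t = 0" "s < 0" | "0 < t" "s < 0" | "0 < t" "(\<alpha> + \<beta>) * t < s"
      | "0 < t" "0 \<le> s" "s \<le> (\<alpha> + \<beta>) * t" using t by linarith
    then show ?thesis
    proof cases
      case 1
      then show ?thesis
        by (intro exI[of _ "(1, 0)"] exI[of _ "(1, 0)"] exI[of _ "nat s"] exI[of _ 0])
           (auto simp: steps_def same_orthant_def)
    next
      case 2
      then show ?thesis
        by (intro exI[of _ "(-1, 0)"] exI[of _ "(-1, 0)"] exI[of _ "nat (- s)"] exI[of _ 0])
           (auto simp: steps_def same_orthant_def)
    next
      case 3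
      then show ?thesis using pos
        by (intro exI[of _ "(0, 1)"] exI[of _ "(-1, 0)"] exI[of _ "nat t"] exI[of _ "nat (- s)"])
           (auto simp: steps_def same_orthant_def all_less_4)
    next
      case 4
      then show ?thesis using pos
        by (intro exI[of _ "(\<alpha> + \<beta>, 1)"] exI[of _ "(1, 0)"] exI[of _ "nat t"] exI[of _ "nat (s - (\<alpha> + \<beta>) * t)"])
           (auto simp: steps_def same_orthant_def all_less_4 algebra_simps)
    next
      case 5
      \<comment> \<open>Here \<open>(s, t) = (t - r) (c, 1) + r (c + 1, 1)\<close>. At height 1 the
        coordinates change sign only at integers, so \<open>(c, 1)\<close> and
        \<open>(c + 1, 1)\<close> share an orthant.\<close>
      define c where "c = s div t"
      define r where "r = s mod t"
      have r: "0 \<le> r" "r < t" and s: "s = c * t + r" using 5 by (simp_all add: c_def r_def)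
      have c0: "0 \<le> c" using 5 by (simp add: c_def pos_imp_zdiv_nonneg_iff)
      show ?thesis
      proof (cases "r = 0")
        case True
        then have "c \<le> \<alpha> + \<beta>" using 5 s by simp
        then show ?thesis using c0 True s t
          by (intro exI[of _ "(c, 1)"] exI[of _ "(c, 1)"] exI[of _ "nat t"] exI[of _ 0])
             (auto simp: steps_def same_orthant_def mult.commute)
      next
        case False
        then have "c * t < (\<alpha> + \<beta>) * t" using 5 s r by linarith
        then have "c < \<alpha> + \<beta>" using 5 by simp
        then show ?thesis using c0 r s
          by (intro exI[of _ "(c, 1)"] exI[of _ "(c + 1, 1)"] exI[of _ "nat (t - r)"] exI[of _ "nat r"])
             (auto simp: steps_def same_orthant_def all_less_4 algebra_simps)
      qed
    qed
  qed
  show ?thesis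
  proof (cases "0 \<le> snd p")
    case True
    then show ?thesis using nonneg[of "snd p" "fst p"] by simp
  next
    case False
    then obtain u v m n where uv: "u \<in> steps (\<alpha> + \<beta>)" "v \<in> steps (\<alpha> + \<beta>)" "same_orthant \<alpha> \<beta> u v"
      and p: "(- fst p, - snd p) = (int m * fst u + int n * fst v, int m * snd u + int n * snd v)"
      using nonneg[of "- snd p" "- fst p"] by auto
    have "same_orthant \<alpha> \<beta> (- u) (- v)"
      using uv(3) by (auto simp: same_orthant_def coord_uminus)
    moreover have "p = (int m * fst (- u) + int n * fst (- v), int m * snd (- u) + int n * snd (- v))"
      using p by (auto simp: prod_eq_iff)
    ultimately show ?thesis using uv uminus_in_steps by blast
  qed
qed

lemma sum_list_replicate_pair:
  "sum_list (replicate m p) = (int m * fst p, int m * snd p)" for p :: "int \<times> int"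
  by (induction m) (auto simp: prod_eq_iff algebra_simps)

lemma steps_decomposition:
  assumes pos: "1 \<le> \<alpha>" "1 \<le> \<beta>"
  shows "\<exists>ps S. set ps \<subseteq> steps (\<alpha> + \<beta>) \<and> sum_list ps = p \<and>
    (\<forall>q\<in>set ps. \<forall>j<4. if j \<in> S then 0 \<le> coord \<alpha> \<beta> j q else coord \<alpha> \<beta> j q \<le> 0)"
proof -
  obtain u v m n where uv: "u \<in> steps (\<alpha> + \<beta>)" "v \<in> steps (\<alpha> + \<beta>)" "same_orthant \<alpha> \<beta> u v"
    and p: "p = (int m * fst u + int n * fst v, int m * snd u + int n * snd v)"
    using two_steps_decomposition[OF pos] by blast
  define S where "S = {j. 0 \<le> coord \<alpha> \<beta> j u \<and> 0 \<le> coord \<alpha> \<beta> j v}"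
  have "if j \<in> S then 0 \<le> coord \<alpha> \<beta> j q else coord \<alpha> \<beta> j q \<le> 0" if "j < 4" "q = u \<or> q = v" for j q
    using uv(3) that by (auto simp: S_def same_orthant_def)
  then show ?thesis using uv p
    by (intro exI[of _ "replicate m u @ replicate n v"] exI[of _ S])
       (auto simp: sum_list_replicate_pair split: if_splits)
qed

text \<open>The steps of a layer share an orthant, so every subfamily sums layerwise to a vector
  conformally below \<open>x\<close>. If its total is zero, this vector is in the kernel, and
  primitivity leaves only 0 and \<open>x\<close>; without cancellation the subfamily is then empty
  or everything. The type is bounded by the size of the family because each nonzero layer
  contributes at least one step.\<close>

lemma vec_type_primitive_le:
  assumes a: "a = d * \<alpha>" and b: "b = d * \<beta>" and pos: "0 < d" "0 < \<alpha>" "0 < \<beta>" and coprime: "coprime \<alpha> \<beta>"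
    and prim: "primitive (lawrence_lifting (A_mat a b) N) x"
  shows "vec_type 4 N x \<le> 2 * (\<alpha> + \<beta>)"
proof -
  let ?c = "coord (int \<alpha>) (int \<beta>)" and ?st = "stack (int \<alpha>) (int \<beta>) N" and ?l = "int \<alpha> + int \<beta>"
  let ?L = "lawrence_lifting (A_mat a b) N"
  have pos': "1 \<le> int \<alpha>" "1 \<le> int \<beta>" "?l \<noteq> 0" using pos by auto
  note ker = mat_kernel_lawrence_A_mat[OF a b pos coprime, of _ N]
  have dim_L: "dim_col ?L = N * 4" by (simp add: lawrence_lifting_def Let_def)
  obtain q where x: "x = ?st q" and q: "(\<Sum>k<N. q k) = 0"
    using prim ker by (auto simp: primitive_def)
  have "\<forall>k. \<exists>ps S. set ps \<subseteq> steps ?l \<and> sum_list ps = q k \<and>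
      (\<forall>r\<in>set ps. \<forall>j<4. if j \<in> S then 0 \<le> ?c j r else ?c j r \<le> 0)"
    using steps_decomposition[OF pos'(1,2)] by (intro allI)
  then obtain ps S where psS: "\<forall>k. set (ps k) \<subseteq> steps ?l \<and> sum_list (ps k) = q k \<and>
      (\<forall>r\<in>set (ps k). \<forall>j<4. if j \<in> S k then 0 \<le> ?c j r else ?c j r \<le> 0)"
    unfolding choice_iff by (elim exE)
  have ps: "\<And>k. set (ps k) \<subseteq> steps ?l" "\<And>k. sum_list (ps k) = q k"
    and S: "\<And>k r j. r \<in> set (ps k) \<Longrightarrow> j < 4 \<Longrightarrow> if j \<in> S k then 0 \<le> ?c j r else ?c j r \<le> 0"
    using psS by blast+
  \<comment> \<open>Indexing by layer and position keeps repeated steps apart.\<close>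
  define I where "I = (SIGMA k:{..<N}. {..<length (ps k)})"
  define f where "f = (\<lambda>(k, i). ps k ! i)"
  have fin: "finite I" by (simp add: I_def)
  have f: "f (k, i) \<in> set (ps k)" if "(k, i) \<in> I" for k i
    using that by (auto simp: I_def f_def)
  define part where "part J k = (\<Sum>i\<in>{i. (k, i) \<in> J}. f (k, i))" for J k
  have fin_part: "finite {i. (k, i) \<in> J}" if "J \<subseteq> I" for J k
    using that by (intro finite_subset[of "{i. (k, i) \<in> J}" "{..<length (ps k)}"]) (auto simp: I_def)
  have sum_part: "sum f J = (\<Sum>k<N. part J k)" if J: "J \<subseteq> I" for J
  proof -
    have "J = (SIGMA k:{..<N}. {i. (k, i) \<in> J})" using J by (auto simp: I_def)
    then have "sum f J = sum f (SIGMA k:{..<N}. {i. (k, i) \<in> J})" by simp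
    also have "\<dots> = (\<Sum>k<N. part J k)"
      unfolding part_def using fin_part[OF J] by (subst sum.Sigma) (auto simp: case_prod_unfold)
    finally show ?thesis .
  qed
  have part_I: "part I k = q k" if "k < N" for k
  proof -
    have "{i. (k, i) \<in> I} = {0..<length (ps k)}" using that by (auto simp: I_def)
    then show ?thesis by (simp add: part_def f_def sum_list_sum_nth flip: ps(2))
  qed
  have part_diff: "part (I - J) k = q k - part J k" if J: "J \<subseteq> I" and k: "k < N" for J k
  proof -
    have "{i. (k, i) \<in> I - J} = {i. (k, i) \<in> I} - {i. (k, i) \<in> J}" by auto
    then have "part (I - J) k = part I k - part J k"
      unfolding part_def using J fin_part[OF order.refl] by (simp add: sum_diff subset_iff)
    then show ?thesis using part_I[OF k] by simp
  qed
  have sign: "if j \<in> S k then 0 \<le> ?c j (part J k) else ?c j (part J k) \<le> 0" if "J \<subseteq> I" "j < 4" for J k j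
    using S[OF f, of k _ j] that by (auto simp: part_def coord_sum intro!: sum_nonneg sum_nonpos)
  \<comment> \<open>Terms of one sign with sum zero all vanish. Applied to each coordinate, this
    would make some step 0, which is not in \<open>steps\<close>.\<close>
  have part_0: "J = {}" if J: "J \<subseteq> I" and zero: "\<And>k. k < N \<Longrightarrow> part J k = 0" for J
  proof (rule ccontr)
    assume "J \<noteq> {}"
    then obtain k i where ki: "(k, i) \<in> J" by auto
    then have k: "k < N" using J by (auto simp: I_def)
    have "?c j (f (k, i)) = 0" if j: "j < 4" for j
    proof -
      have sum0: "(\<Sum>i\<in>{i. (k, i) \<in> J}. ?c j (f (k, i))) = 0"
        using zero[OF k] by (simp add: part_def flip: coord_sum)
      show ?thesis
      proof (cases "j \<in> S k")
        case True
        then have "\<forall>i\<in>{i. (k, i) \<in> J}. ?c j (f (k, i)) = 0"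
          using S[OF f, of k _ j] j J sum0 fin_part[OF J, of k]
          by (subst sum_nonneg_eq_0_iff[symmetric]) auto
        then show ?thesis using ki by simp
      next
        case False
        have "(\<Sum>i\<in>{i. (k, i) \<in> J}. - ?c j (f (k, i))) = 0" using sum0 by (simp add: sum_negf)
        then have "\<forall>i\<in>{i. (k, i) \<in> J}. - ?c j (f (k, i)) = 0"
          using S[OF f, of k _ j] j J False fin_part[OF J, of k]
          by (subst sum_nonneg_eq_0_iff[symmetric]) auto
        then show ?thesis using ki by simp
      qed
    qed
    then have "f (k, i) = 0" by (rule coord_eq_0[OF pos'(3)])
    moreover have "f (k, i) \<in> steps ?l" using f[of k i] ki J ps(1) by blast
    ultimately show False using zero_notin_steps by metis
  qed
  have min: "minimal_zero_sum I f"
    unfolding minimal_zero_sum_def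
  proof (intro conjI allI impI)
    show "finite I" by (rule fin)
    show "sum f I = 0" using q sum_part[OF order.refl] part_I by simp
    fix J assume J: "J \<subseteq> I" and J0: "sum f J = 0"
    have "?st (part J) \<in> mat_kernel ?L" using ker J0 sum_part[OF J] by auto
    moreover have "conformal_le (?st (part J)) x"
      unfolding conformal_le_def
    proof (intro allI impI)
      fix i assume "i < dim_vec x"
      then have i: "i div 4 < N" "i mod 4 < 4" by (auto simp: x less_mult_imp_div_less)
      define k j where "k = i div 4" and "j = i mod 4"
      have "x $ i = ?c j (q k)" "?st (part J) $ i = ?c j (part J k)"
        using \<open>i < dim_vec x\<close> by (simp_all add: x stack_def k_def j_def)
      moreover have "q k = part J k + part (I - J) k" using part_diff[OF J i(1)] by (simp add: k_def)
      ultimately have "x $ i = ?st (part J) $ i + ?c j (part (I - J) k)" by (simp add: coord_add)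
      then show "0 \<le> ?st (part J) $ i \<and> ?st (part J) $ i \<le> x $ i \<or>
          x $ i \<le> ?st (part J) $ i \<and> ?st (part J) $ i \<le> 0"
        using sign[OF J, of j k] sign[of "I - J" j k] i \<open>?st (part J) $ i = _\<close>
        by (cases "j \<in> S k") (auto simp: j_def)
    qed
    ultimately have "?st (part J) = 0\<^sub>v (N * 4) \<or> ?st (part J) = x"
      using prim dim_L by (simp add: primitive_def)
    then consider "\<And>k. k < N \<Longrightarrow> part J k = 0" | "\<And>k. k < N \<Longrightarrow> part J k = q k"
      unfolding x stack_0[symmetric, of N "int \<alpha>" "int \<beta>"] stack_eq_iff[OF pos'(3)] by blast
    then show "J = {} \<or> J = I"
    proof cases
      case 1
      then show ?thesis using part_0[OF J] by simp
    next
      case 2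
      then have "I - J = {}" using part_diff[OF J] by (intro part_0) auto
      then show ?thesis using J by blast
    qed
  qed
  have "int (card I) \<le> 2 * ?l"
  proof (rule card_minimal_zero_sum_steps_le[OF min])
    fix i assume "i \<in> I"
    then show "f i \<in> steps ?l" using f[of "fst i" "snd i"] ps(1) by auto
  qed (use pos' in simp)
  then have "int (card I) \<le> int (2 * (\<alpha> + \<beta>))" by simp
  then have "card I \<le> 2 * (\<alpha> + \<beta>)" by (simp only: of_nat_le_iff)
  moreover have "vec_type 4 N x \<le> card I"
  proof -
    have "(k, 0) \<in> I" if "k < N" "layer 4 x k \<noteq> 0\<^sub>v 4" for k
      using that ps(2)[of k] layer_stack_eq_0_iff[OF pos'(3), of k N q] by (cases "ps k") (auto simp: x I_def)
    then have "(\<lambda>k. (k, 0)) ` {k. k < N \<and> layer 4 x k \<noteq> 0\<^sub>v 4} \<subseteq> I" by auto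
    then have "card ((\<lambda>k. (k, 0::nat)) ` {k. k < N \<and> layer 4 x k \<noteq> 0\<^sub>v 4}) \<le> card I"
      by (rule card_mono[OF fin])
    then show ?thesis by (simp add: vec_type_def card_image inj_on_def)
  qed
  ultimately show ?thesis by (rule order_trans[rotated])
qed

section \<open>Weight orderings\<close>

definition weight :: "nat \<Rightarrow> (nat \<Rightarrow> nat) \<Rightarrow> monomial \<Rightarrow> nat" where
  "weight n c t = (\<Sum>i<n. c i * Poly_Mapping.lookup t i)"

text \<open>Ties are broken by the order on \<open>monomial\<close>, which is lexicographic with the
  variable of index \<open>0\<close> most significant.\<close>

definition weight_order :: "nat \<Rightarrow> (nat \<Rightarrow> nat) \<Rightarrow> monomial rel" where
  "weight_order n c = {(s, t). s \<in> monomials n \<and> t \<in> monomials n \<and>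
     (weight n c s < weight n c t \<or> weight n c s = weight n c t \<and> s \<le> t)}"

lemma zero_le_monomial: "(0 :: monomial) \<le> t"
proof (rule ccontr)
  assume "\<not> 0 \<le> t"
  then have "t < 0" by simp
  then show False by (simp add: less_poly_mapping.rep_eq less_fun_def)
qed

lemma weight_add: "weight n c (s + t) = weight n c s + weight n c t"
  by (simp add: weight_def lookup_add distrib_left sum.distrib)

lemma term_ordering_weight_order: "term_ordering n (weight_order n c)"
  unfolding term_ordering_def order_on_defs
proof (intro conjI ballI impI)
  show "weight_order n c \<subseteq> monomials n \<times> monomials n" by (auto simp: weight_order_def)
  show "refl_on (monomials n) (weight_order n c)" by (auto simp: weight_order_def refl_on_def)
  show "trans (weight_order n c)" by (rule transI) (auto simp: weight_order_def)
  show "antisym (weight_order n c)" by (rule antisymI) (auto simp: weight_order_def)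
  show "total_on (monomials n) (weight_order n c)" by (auto simp: weight_order_def total_on_def)
  show "(0, t) \<in> weight_order n c" if "t \<in> monomials n" for t
  proof -
    have "weight n c 0 = 0" by (simp add: weight_def)
    then show ?thesis using that by (auto simp: weight_order_def zero_le_monomial)
  qed
  show "(s + u, t + u) \<in> weight_order n c"
    if "s \<in> monomials n" "t \<in> monomials n" "u \<in> monomials n" "(s, t) \<in> weight_order n c" for s t u
    using that by (auto simp: weight_order_def weight_add add_in_monomials_iff intro: add_right_mono)
qed

section \<open>The lower bound\<close>

text \<open>One layer \<open>(\<alpha> + \<beta>, 1)\<close>, then \<open>\<alpha> + \<beta> - 1\<close> layers \<open>(0, 1)\<close>, then \<open>\<alpha> + \<beta>\<close> layers
  \<open>(-1, -1)\<close>: a minimal zero-sum sequence of the maximal length.\<close>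

definition long_layer :: "nat \<Rightarrow> nat \<Rightarrow> int \<times> int" where
  "long_layer l k = (if k = 0 then (int l, 1) else if k < l then (0, 1) else (-1, -1))"

text \<open>The layer polytopes \<open>{z. z \<ge> 0 \<and> A z = A (w\<^sup>k)\<^sup>+}\<close> of the vector \<open>w\<close> above have the segment
  from \<open>(w\<^sup>k)\<^sup>+\<close> to \<open>(w\<^sup>k)\<^sup>-\<close> as an edge; this weight is minimal exactly on these edges.\<close>

definition long_weight :: "nat \<Rightarrow> nat \<Rightarrow> nat" where
  "long_weight l i =
     (let k = i div 4; j = i mod 4 in
      if k = 0 then (if j = 1 then 1 else 0)
      else if k < l then (if j = 2 then 1 else 0)
      else (if j = 1 then 1 else if j = 2 then l - 1 else 0))"

lemma sum_long_layer:
  assumes "S \<subseteq> {..<2 * l}" "0 < l"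
  shows "(\<Sum>k\<in>S. long_layer l k) =
    (int l * (if 0 \<in> S then 1 else 0) - int (card (S \<inter> {l..})), int (card (S \<inter> {..<l})) - int (card (S \<inter> {l..})))"
proof -
  have fin: "finite S" using assms finite_subset by blast
  have *: "fst (long_layer l k) = (if k = 0 then int l else 0) - (if k \<in> {l..} then 1 else 0)"
    "snd (long_layer l k) = (if k \<in> {..<l} then 1 else 0) - (if k \<in> {l..} then 1 else 0)" for k
    using assms(2) by (auto simp: long_layer_def)
  have count: "(\<Sum>k\<in>S. if k \<in> T then 1 else 0) = int (card (S \<inter> T))" for T
    using fin by (simp flip: sum.inter_restrict)
  show ?thesis
    using fin
    by (intro prod_eqI) (simp_all add: fst_sum snd_sum sum_subtractf * count del: atLeast_iff lessThan_iff)
qed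

text \<open>Only layer 0 has a positive first entry, and cancelling its \<open>l\<close> takes all
  \<open>l\<close> layers \<open>(-1, -1)\<close>; the heights then require all \<open>l\<close>
  layers of height 1. Without layer 0 no layer \<open>(-1, -1)\<close> can occur, and hence none of
  height 1.\<close>

lemma long_layer_minimal:
  assumes S: "S \<subseteq> {..<2 * l}" and l: "0 < l" and sum: "(\<Sum>k\<in>S. long_layer l k) = 0"
  shows "S = {} \<or> S = {..<2 * l}"
proof -
  have fin: "finite S" using S finite_subset by blast
  have eq: "int l * (if 0 \<in> S then 1 else 0) = int (card (S \<inter> {l..}))"
    "card (S \<inter> {..<l}) = card (S \<inter> {l..})"
    using sum sum_long_layer[OF S l] by (simp_all add: zero_prod_def)
  have split: "S = S \<inter> {..<l} \<union> S \<inter> {l..}" by auto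
  show ?thesis
  proof (cases "0 \<in> S")
    case True
    then have cards: "card (S \<inter> {l..}) = l" "card (S \<inter> {..<l}) = l" using eq by simp_all
    have "S \<inter> {l..} = {l..<2 * l}"
      using S cards(1) by (intro card_subset_eq) auto
    moreover have "S \<inter> {..<l} = {..<l}"
      using cards(2) by (intro card_subset_eq) auto
    ultimately have "S = {..<l} \<union> {l..<2 * l}" using split by simp
    then show ?thesis by auto
  next
    case False
    then have "S \<inter> {l..} = {}" "S \<inter> {..<l} = {}" using eq fin by auto
    then show ?thesis using split by simp
  qed
qed

lemma sum_long_layer_0: "0 < l \<Longrightarrow> (\<Sum>k<2 * l. long_layer l k) = 0"
  using sum_long_layer[of "{..<2 * l}" l]
  by (simp add: zero_prod_def lessThan_minus_lessThan Int_absorb1 subset_iff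
      atLeastLessThan_def[symmetric] Int_commute[of "{..<_}" "{_..}"] flip: atLeastLessThan_def)

lemma sum_less_4: "sum f {..<4} = f 0 + f (Suc 0) + f 2 + (f 3 :: 'a::comm_monoid_add)"
  by (simp add: eval_nat_numeral)

text \<open>The change of weight when layer \<open>k\<close> is displaced by \<open>p\<close>: a
  linear form in \<open>p\<close> that vanishes in the direction \<open>long_layer l k\<close> of
  the edge.\<close>

definition layer_cost :: "nat \<Rightarrow> nat \<Rightarrow> int \<times> int \<Rightarrow> int" where
  "layer_cost l k p =
     (if k = 0 then int l * snd p - fst p else if k < l then - fst p else int l * (snd p - fst p))"

lemma long_weight_layer:
  assumes pos: "1 \<le> \<alpha>" "1 \<le> \<beta>"
  defines "l \<equiv> \<alpha> + \<beta>"
  shows "(\<Sum>j<4. int (long_weight l (k * 4 + j)) * coord (int \<alpha>) (int \<beta>) j p) = layer_cost l k p"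
proof -
  let ?w = "\<lambda>j. if k = 0 then (if j = 1 then 1 else 0) else if k < l then (if j = 2 then 1 else 0)
       else (if j = 1 then 1 else if j = 2 then l - 1 else (0 :: nat))"
  have weight: "(\<Sum>j<4. int (long_weight l (k * 4 + j)) * coord (int \<alpha>) (int \<beta>) j p) =
      (\<Sum>j<4. int (?w j) * coord (int \<alpha>) (int \<beta>) j p)"
    by (rule sum.cong) (simp_all add: long_weight_def)
  have l: "int (l - Suc 0) = int l - 1" "int \<alpha> + int \<beta> = int l" using pos by (simp_all add: l_def)
  consider "k = 0" | "0 < k" "k < l" | "0 < k" "l \<le> k" by linarith
  then show ?thesis
    unfolding weight sum_less_4 layer_cost_def
    by cases (simp_all add: l algebra_simps)
qed

text \<open>Here \<open>p\<close> displaces the positive part of the layer, and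
  \<open>nonneg\<close> keeps the result in the layer polytope. For the first two kinds of layers
  the cost is a coordinate that is 0 at the positive part, so it can only grow. For
  \<open>(-1, -1)\<close> the inequalities confine the height of \<open>p\<close> to 0 and
  1.\<close>

lemma long_layer_edge:
  assumes pos: "1 \<le> \<alpha>" "1 \<le> \<beta>"
  defines "l \<equiv> \<alpha> + \<beta>"
  assumes nonneg: "\<And>j. j < 4 \<Longrightarrow>
    0 \<le> max 0 (coord (int \<alpha>) (int \<beta>) j (long_layer l k)) + coord (int \<alpha>) (int \<beta>) j p"
  shows "0 \<le> layer_cost l k p" and "layer_cost l k p = 0 \<Longrightarrow> p = 0 \<or> p = - long_layer l k"
proof -
  obtain s t where p: "p = (s, t)" by (cases p)
  have l: "int l = int \<alpha> + int \<beta>" "2 \<le> int l" using pos by (simp_all add: l_def)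
  have ineq: "0 \<le> max 0 (coord (int \<alpha>) (int \<beta>) j (long_layer l k)) + coord (int \<alpha>) (int \<beta>) j (s, t)"
    if "j < 4" for j
    using nonneg[OF that] p by simp
  note n = ineq[of 0, simplified] ineq[of 1, simplified] ineq[of 2, simplified] ineq[of 3, simplified]
  consider "k = 0" | "0 < k" "k < l" | "l \<le> k" "0 < k" using pos by (force simp: l_def)
  then have "0 \<le> layer_cost l k p \<and> (layer_cost l k p = 0 \<longrightarrow> p = 0 \<or> p = - long_layer l k)"
  proof cases
    case 1
    then have q: "long_layer l k = (int l, 1)" by (simp add: long_layer_def)
    have b: "0 \<le> int \<alpha> + s - int \<beta> * t" "0 \<le> int l * t - s" "s \<le> 0"
      using n q l by (simp_all add: algebra_simps)
    have "t = 0 \<or> t = -1" if "s = int l * t"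
    proof -
      have "0 \<le> int \<alpha> * (1 + t)" using b(1) that l by (simp add: algebra_simps)
      then have "-1 \<le> t" using pos by (simp add: zero_le_mult_iff)
      moreover have "t \<le> 0" using b(3) that l by (simp add: mult_le_0_iff)
      ultimately show ?thesis by linarith
    qed
    then show ?thesis using 1 b q by (auto simp: p zero_prod_def layer_cost_def)
  next
    case 2
    then have q: "long_layer l k = (0, 1)" by (simp add: long_layer_def)
    have b: "0 \<le> s - int \<beta> * t" "0 \<le> int l + int l * t - s" "s \<le> 0"
      using n q l by (simp_all add: algebra_simps)
    have "t = 0 \<or> t = -1" if "s = 0"
    proof -
      have "0 \<le> int l * (1 + t)" using b(2) that by (simp add: algebra_simps)
      then have "-1 \<le> t" using l by (simp add: zero_le_mult_iff)
      moreover have "t \<le> 0" using b(1) that pos by (simp add: mult_le_0_iff)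
      ultimately show ?thesis by linarith
    qed
    then show ?thesis using 2 b q by (auto simp: p zero_prod_def layer_cost_def)
  next
    case 3
    then have q: "long_layer l k = (-1, -1)" by (simp add: long_layer_def)
    have b: "0 \<le> int \<beta> - 1 + s - int \<beta> * t" "s \<le> int l * t" "s \<le> 1" "0 \<le> int \<alpha> - 1 + s - int \<alpha> * t"
      using n q l pos by (simp_all add: algebra_simps max_def split: if_splits)
    \<comment> \<open>The lower bounds on \<open>s\<close> from coordinates 0 and 3 add up to
      \<open>l t - l + 2 \<le> 2 s\<close>; with \<open>s \<le> l t\<close> this excludes negative
      \<open>t\<close>.\<close>
    have "int l * 0 < int l * (1 + t)" using b l by (simp add: algebra_simps)
    then have t: "0 \<le> t" using l by (simp add: zero_less_mult_iff)
    have "int \<alpha> * (t - 1) \<le> int \<alpha> * 0" using b by (simp add: algebra_simps)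
    then have "t \<le> 1" using pos by (simp add: mult_le_0_iff)
    with t have "t = 0 \<or> t = 1" by linarith
    then have "t = 0 \<and> s \<le> 0 \<or> t = 1 \<and> s = 1" using b by auto
    then show ?thesis using 3 q l by (auto simp: p zero_prod_def layer_cost_def mult_le_0_iff)
  qed
  then show "0 \<le> layer_cost l k p" and "layer_cost l k p = 0 \<Longrightarrow> p = 0 \<or> p = - long_layer l k" by blast+
qed

lemma weight_diff:
  assumes pos: "1 \<le> \<alpha>" "1 \<le> \<beta>"
    and diff: "exponent_vec (N * 4) s - exponent_vec (N * 4) t = stack (int \<alpha>) (int \<beta>) N p"
  shows "int (weight (N * 4) (long_weight (\<alpha> + \<beta>)) s) - int (weight (N * 4) (long_weight (\<alpha> + \<beta>)) t) =
    (\<Sum>k<N. layer_cost (\<alpha> + \<beta>) k (p k))"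
proof -
  let ?w = "long_weight (\<alpha> + \<beta>)"
  have "int (weight (N * 4) ?w s) - int (weight (N * 4) ?w t) =
      (\<Sum>i<N * 4. int (?w i) * (int (Poly_Mapping.lookup s i) - int (Poly_Mapping.lookup t i)))"
    by (simp add: weight_def right_diff_distrib sum_subtractf)
  also have "\<dots> = (\<Sum>i<N * 4. int (?w i) * stack (int \<alpha>) (int \<beta>) N p $ i)"
    by (intro sum.cong refl) (simp add: exponent_vec_def flip: diff)
  also have "\<dots> = (\<Sum>k<N. \<Sum>j<4. int (?w (k * 4 + j)) * coord (int \<alpha>) (int \<beta>) j (p k))"
    unfolding sum_blocks by (intro sum.cong refl) (simp add: stack_index)
  also have "\<dots> = (\<Sum>k<N. layer_cost (\<alpha> + \<beta>) k (p k))"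
    by (simp only: long_weight_layer[OF pos])
  finally show ?thesis .
qed

lemma exponent_vec_parts:
  assumes "dim_vec w = n"
  shows "exponent_vec n (exponent (pos_part w)) - exponent_vec n (exponent (neg_part w)) = w"
  using assms
  by (intro eq_vecI) (simp_all add: exponent_vec_def lookup_exponent_pos_part lookup_exponent_neg_part)

lemma exponent_vec_inj:
  assumes "exponent_vec n s = exponent_vec n t" "s \<in> monomials n" "t \<in> monomials n"
  shows "s = t"
proof (rule poly_mapping_eqI)
  fix i
  show "Poly_Mapping.lookup s i = Poly_Mapping.lookup t i"
    using arg_cong[OF assms(1), of "\<lambda>v. v $ i"] lookup_monomials[OF assms(2), of i] lookup_monomials[OF assms(3), of i]
    by (cases "i < n") (simp_all add: exponent_vec_def)
qed

lemma layer_cost_long_layer: "layer_cost l k (long_layer l k) = 0"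
  by (simp add: layer_cost_def long_layer_def)

lemma long_vector_in_reduced_groebner_vectors:
  assumes a: "a = d * \<alpha>" and b: "b = d * \<beta>" and pos: "0 < d" "0 < \<alpha>" "0 < \<beta>" and coprime: "coprime \<alpha> \<beta>"
  defines "l \<equiv> \<alpha> + \<beta>"
  defines "L \<equiv> lawrence_lifting (A_mat a b) (2 * l)"
  shows "stack (int \<alpha>) (int \<beta>) (2 * l) (long_layer l) \<in>
    reduced_groebner_vectors TYPE('k::field) L (weight_order (dim_col L) (long_weight l))"
proof -
  let ?st = "stack (int \<alpha>) (int \<beta>) (2 * l)" and ?n = "2 * l * 4" and ?w = "long_weight l"
  define x where "x = ?st (long_layer l)"
  define P M where "P = exponent (pos_part x)" and "M = exponent (neg_part x)"
  have pos': "1 \<le> \<alpha>" "1 \<le> \<beta>" "int \<alpha> + int \<beta> \<noteq> 0" "0 < l" using pos by (auto simp: l_def)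
  have dim_L: "dim_col L = ?n" by (simp add: L_def lawrence_lifting_def Let_def)
  note ker = mat_kernel_lawrence_A_mat[OF a b pos coprime, of _ "2 * l", folded L_def]
  have x: "x \<in> mat_kernel L" using ker sum_long_layer_0[OF pos'(4)] by (auto simp: x_def)
  have dim_x: "dim_vec x = ?n" by (simp add: x_def)
  have long_ne: "long_layer l k \<noteq> 0" for k by (simp add: long_layer_def zero_prod_def)
  have mem: "P \<in> monomials ?n" "M \<in> monomials ?n"
    using exponent_parts_in_monomials[OF dim_x] by (simp_all add: P_def M_def)
  have x_index: "x $ (k * 4 + j) = coord (int \<alpha>) (int \<beta>) j (long_layer l k)" if "k < 2 * l" "j < 4" for k j
    using that by (simp add: x_def stack_index)
  have diff_PM: "exponent_vec ?n P - exponent_vec ?n M = x"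
    unfolding P_def M_def by (rule exponent_vec_parts[OF dim_x])
  have weight_PM: "weight ?n ?w P = weight ?n ?w M"
    using weight_diff[OF pos'(1,2) diff_PM[unfolded x_def]] by (simp add: l_def layer_cost_long_layer)
  \<comment> \<open>\<open>P\<close> and \<open>M\<close> have equal weight, so the tie-break
    decides. The first entry of layer 0 is \<open>l - \<beta> = \<alpha>\<close>, which is positive
    and makes \<open>P\<close> the larger one.\<close>
  have "x $ 0 = int \<alpha>"
    using x_index[of 0 0] pos' by (simp add: long_layer_def l_def)
  then have "Poly_Mapping.lookup M 0 < Poly_Mapping.lookup P 0"
    using pos' dim_x by (simp add: P_def M_def lookup_exponent_pos_part lookup_exponent_neg_part)
  then have "M < P"
    by (auto simp: less_poly_mapping.rep_eq less_fun_def intro: exI[of _ 0])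
  then have lead: "(M, P) \<in> weight_order ?n ?w"
    using mem weight_PM by (simp add: weight_order_def)
  have smallest: "u = P \<or> u = M" if fiber: "same_fiber L u P" and le: "(u, P) \<in> weight_order ?n ?w" for u
  proof -
    have u: "u \<in> monomials ?n" using le by (simp add: weight_order_def)
    obtain p where p: "exponent_vec ?n u - exponent_vec ?n P = ?st p" and p0: "(\<Sum>k<2 * l. p k) = 0"
      using same_fiber_diff_in_mat_kernel[OF fiber] dim_L ker by auto
    have edge: "0 \<le> layer_cost l k (p k)" "layer_cost l k (p k) = 0 \<Longrightarrow> p k = 0 \<or> p k = - long_layer l k"
      if k: "k < 2 * l" for k
    proof -
      have "0 \<le> max 0 (coord (int \<alpha>) (int \<beta>) j (long_layer l k)) + coord (int \<alpha>) (int \<beta>) j (p k)"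
        if j: "j < 4" for j
      proof -
        have i: "k * 4 + j < ?n" by (rule layer_index_less[OF k j])
        have "int (Poly_Mapping.lookup u (k * 4 + j)) - int (Poly_Mapping.lookup P (k * 4 + j)) =
            coord (int \<alpha>) (int \<beta>) j (p k)"
          using arg_cong[OF p, of "\<lambda>v. v $ (k * 4 + j)"] i stack_index[OF k j] by (simp add: exponent_vec_def)
        moreover have "int (Poly_Mapping.lookup P (k * 4 + j)) = max 0 (coord (int \<alpha>) (int \<beta>) j (long_layer l k))"
          using i dim_x x_index[OF k j] by (simp add: P_def lookup_exponent_pos_part)
        ultimately show ?thesis by linarith
      qed
      note * = long_layer_edge[OF pos'(1,2), folded l_def, OF this]
      show "0 \<le> layer_cost l k (p k)" by (rule *(1))
      show "layer_cost l k (p k) = 0 \<Longrightarrow> p k = 0 \<or> p k = - long_layer l k" by (rule *(2))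
    qed
    have "weight ?n ?w u \<le> weight ?n ?w P" using le by (auto simp: weight_order_def)
    then have "(\<Sum>k<2 * l. layer_cost l k (p k)) \<le> 0"
      using weight_diff[OF pos'(1,2) p] by (simp add: l_def)
    moreover have "0 \<le> (\<Sum>k<2 * l. layer_cost l k (p k))" using edge(1) by (intro sum_nonneg) simp
    ultimately have "(\<Sum>k<2 * l. layer_cost l k (p k)) = 0" by simp
    then have "\<forall>k\<in>{..<2 * l}. layer_cost l k (p k) = 0"
      using edge(1) by (subst (asm) sum_nonneg_eq_0_iff) auto
    then have p_cases: "p k = 0 \<or> p k = - long_layer l k" if "k < 2 * l" for k
      using edge(2)[OF that] that by simp
    \<comment> \<open>\<open>S\<close> is the set of flipped layers. As the \<open>p k\<close> sum
      to zero, it is a zero-sum subfamily of the long family; flipping nothing gives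
      \<open>P\<close>, flipping everything gives \<open>M\<close>.\<close>
    define S where "S = {k. k < 2 * l \<and> p k = - long_layer l k}"
    have p_S: "p k = (if k \<in> S then - long_layer l k else 0)" if "k < 2 * l" for k
      using p_cases[OF that] that by (auto simp: S_def)
    have S: "S \<subseteq> {..<2 * l}" by (auto simp: S_def)
    have "0 = (\<Sum>k<2 * l. if k \<in> S then - long_layer l k else 0)"
      using p0 p_S by simp
    also have "\<dots> = - (\<Sum>k\<in>S. long_layer l k)"
      using S by (simp add: sum_negf Int_absorb1 flip: sum.inter_restrict)
    finally have "S = {} \<or> S = {..<2 * l}"
      by (intro long_layer_minimal[OF S pos'(4)]) simp
    then show ?thesis
    proof
      assume "S = {}"
      then have "?st p = ?st (\<lambda>_. 0)" using p_S by (subst stack_eq_iff[OF pos'(3)]) simp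
      then have zero: "exponent_vec ?n u - exponent_vec ?n P = 0\<^sub>v ?n" using p stack_0 by simp
      have "exponent_vec ?n u = exponent_vec ?n P"
      proof (rule eq_vecI)
        fix i assume "i < dim_vec (exponent_vec ?n P)"
        then show "exponent_vec ?n u $ i = exponent_vec ?n P $ i"
          using arg_cong[OF zero, of "\<lambda>v. v $ i"] by (simp add: exponent_vec_def)
      qed (simp add: exponent_vec_def)
      then show ?thesis using exponent_vec_inj u mem by blast
    next
      assume "S = {..<2 * l}"
      then have "?st p = ?st (\<lambda>k. - long_layer l k)" using p_S by (subst stack_eq_iff[OF pos'(3)]) simp
      also have "\<dots> = - x" by (auto simp: x_def stack_def coord_uminus)
      finally have eq: "exponent_vec ?n u - exponent_vec ?n P = - x" using p by simp
      have "exponent_vec ?n u = exponent_vec ?n M"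
      proof (rule eq_vecI)
        fix i assume "i < dim_vec (exponent_vec ?n M)"
        then show "exponent_vec ?n u $ i = exponent_vec ?n M $ i"
          using arg_cong[OF eq, of "\<lambda>v. v $ i"] arg_cong[OF diff_PM, of "\<lambda>v. v $ i"] dim_x
          by (simp add: exponent_vec_def)
      qed (simp add: exponent_vec_def)
      then show ?thesis using exponent_vec_inj u mem by blast
    qed
  qed
  have "\<not> (\<forall>k<2 * l. long_layer l k = 0)" using long_ne pos'(4) by (auto intro: exI[of _ 0])
  then have "x \<noteq> 0\<^sub>v (dim_col L)"
    unfolding x_def dim_L stack_0[symmetric, of "2 * l" "int \<alpha>" "int \<beta>"] stack_eq_iff[OF pos'(3)] .
  then have "x \<in> reduced_groebner_vectors TYPE('k) L (weight_order (dim_col L) ?w)"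
    using x lead smallest
    by (intro reduced_groebner_vectorsI[OF term_ordering_weight_order]) (simp_all add: dim_L P_def M_def)
  then show ?thesis by (simp add: x_def)
qed

section \<open>Comparison of the two complexities\<close>

lemma universal_groebner_basis_primitive:
  assumes "w \<in> universal_groebner_basis TYPE('k::field) A"
  shows "primitive A w"
proof -
  obtain r where r: "term_ordering (dim_col A) r"
    "w \<in> reduced_groebner_vectors TYPE('k) A r \<union> uminus ` reduced_groebner_vectors TYPE('k) A r"
    using assms by (auto simp: universal_groebner_basis_def)
  then show ?thesis
    using reduced_groebner_vector_primitive[OF r(1), where 'k = 'k] primitive_uminus by auto
qed

theorem lemma4:
  fixes a b :: nat
  assumes "0 < a" and "0 < b"
  shows "groebner_complexity TYPE('k::field) (A_mat a b) = graver_complexity (A_mat a b) \<and>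
         graver_complexity (A_mat a b) = enat (2 * (a + b) div gcd a b)"
proof -
  define d where "d = gcd a b"
  have d: "0 < d" using assms by (simp add: d_def)
  then obtain \<alpha> \<beta> where "a = \<alpha> * d" "b = \<beta> * d" and coprime: "coprime \<alpha> \<beta>"
    using gcd_coprime_exists[of a b] unfolding d_def by blast
  then have a: "a = d * \<alpha>" and b: "b = d * \<beta>" by (simp_all only: mult.commute)
  have pos: "0 < d" "0 < \<alpha>" "0 < \<beta>" using assms a b d by auto
  define l where "l = \<alpha> + \<beta>"
  have "2 * (a + b) = d * (2 * l)" by (simp add: a b l_def algebra_simps)
  then have value_eq: "2 * (a + b) div gcd a b = 2 * l" using d by (simp flip: d_def)
  let ?A = "A_mat a b"
  let ?U = "{enat (vec_type 4 N x) | N x. 0 < N \<and> x \<in> universal_groebner_basis TYPE('k) (lawrence_lifting ?A N)}"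
  let ?G = "{enat (vec_type 4 N x) | N x. 0 < N \<and> x \<in> graver_basis (lawrence_lifting ?A N)}"
  have subset: "?U \<subseteq> ?G"
    using universal_groebner_basis_primitive[where 'k = 'k] by (auto simp: graver_basis_iff_primitive)
  have upper: "Sup ?G \<le> enat (2 * l)"
    using vec_type_primitive_le[OF a b pos coprime]
    by (intro Sup_least) (auto simp: graver_basis_iff_primitive l_def)
  define x where "x = stack (int \<alpha>) (int \<beta>) (2 * l) (long_layer l)"
  have x: "x \<in> universal_groebner_basis TYPE('k) (lawrence_lifting ?A (2 * l))"
    using long_vector_in_reduced_groebner_vectors[OF a b pos coprime, where 'k = 'k] term_ordering_weight_order
    unfolding universal_groebner_basis_def x_def l_def by blast
  have "layer 4 x k \<noteq> 0\<^sub>v 4" if "k < 2 * l" for k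
    using layer_stack_eq_0_iff[OF _ that, of "int \<alpha>" "int \<beta>" "long_layer l"] pos
    by (simp add: x_def long_layer_def zero_prod_def)
  then have "vec_type 4 (2 * l) x = card {..<2 * l}"
    unfolding vec_type_def by (intro arg_cong[of _ _ card]) auto
  then have "enat (2 * l) = enat (vec_type 4 (2 * l) x)" by simp
  moreover have "0 < 2 * l" using pos by (simp add: l_def)
  \<comment> \<open>A member of \<open>?U\<close> attains the upper bound for \<open>?G\<close>, and
    \<open>?U\<close> is contained in \<open>?G\<close>, so this value is both suprema.\<close>
  ultimately have "enat (2 * l) \<in> ?U" using x by blast
  then have "enat (2 * l) \<le> Sup ?U" by (rule Sup_upper)
  moreover have "Sup ?U \<le> Sup ?G" by (rule Sup_subset_mono[OF subset])
  ultimately have "Sup ?U = enat (2 * l)" "Sup ?G = enat (2 * l)"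
    using upper by (blast intro: order_antisym order_trans)+
  then show ?thesis
    unfolding value_eq by (simp add: groebner_complexity_def graver_complexity_def)
qed

end
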